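(* Define $\tilde{\mathcal{F}}:\Omega^V\to\mathbb{P}(\mathbb{X})^V$ by $\tilde{\mathcal{F}}(\omega_1,\dots,\omega_V)=(\tilde{\mathcal{F}}(\omega_1),\dots,\tilde{\mathcal{F}}(\omega_V))$. Then $$\tilde{\mathcal{F}}(\eta^a(\omega))=f^a(\tilde{\mathcal{F}}(\omega))\qquad\text{for all }a\in\mathcal{A},\ \omega\in\Omega^V.$$ Also $$\tilde{\mathcal{F}}(\Omega_V)=\tilde{\mathfrak{H}}_V\quad\text{and}\quad\tilde{\mathcal{F}}(\Omega_{V,1})=\tilde{\mathfrak{H}}_{V,1}.$$ Similarly, when $\mathcal{P}^{a}=\dfrac{P_{n_1}P_{n_2}\cdots P_{n_V}}{V^{MV}}$ for every $a\in\mathcal{A}$, we have $$\tilde{\mathcal{F}}(\mu_V)=\tilde{\mathfrak{P}}_V\quad\text{and}\quad\tilde{\mathcal{F}}(\rho_V)=\tilde{\mathfrak{P}}_{V,1},$$ where $\tilde{\mathcal{F}}$ of a measure denotes the push-forward.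
   Context: IFS. An IFS (with probabilities) on a compact metric space $Y$ is a finite family of contraction maps $g_a:Y\to Y$ together with probabilities $p_a\ge 0$, $\sum_a p_a=1$. Its set attractor is the unique non-empty compact $A\subset Y$ with $A=\bigcup_a g_a(A)$; its measure attractor is the unique Borel probability measure $\mu$ on $Y$ with $\mu=\sum_a p_a\, g_a(\mu)$, where $g(\mu)=\mu\circ g^{-1}$. SuperIFS. $(\mathbb{X},d)$ is a compact metric space; $M,N,V$ are positive integers with $M\ge2$. For $n\in\{1,\dots,N\}$, $m\in\{1,\dots,M\}$, $f_m^n:\mathbb{X}\to\mathbb{X}$ is Lipschitz with constant $l$, where $0\le l<1$ is fixed, and $p_m^n\ge0$ with $\sum_{m=1}^Mp_m^n=1$ for each $n$. $P_1,\dots,P_N>0$ with $\sum_nP_n=1$. Code trees. $T$ is the set of all finite sequences over $\{1,\dots,M\}$, including the empty sequence $\emptyset$; $|i|$ is the length of $i\in T$ and $ij$ denotes concatenation. A code tree is a function $\tau:T\to\{1,\dots,N\}$; $\Omega$ is the set of all code trees with metric $d_\Omega(\omega,\varkappa)=M^{-k}$ for $\omega\ne\varkappa$, where $k$ is the least integer such that $\omega(i)\neq\varkappa(i)$ for some $i\in T$ with $|i|=k$. $\Omega^V$ is the $V$-fold product with the maximum metric. The map $\tilde{\mathcal{F}}:\Omega\to\mathbb{P}(\mathbb{X})$. $\mathbb{P}=\mathbb{P}(\mathbb{X})$ is the set of Borel probability measures on $\mathbb{X}$ with the Monge–Kantorovitch metric $d(\mu,\nu)=\sup\{\int f\,d\mu-\int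 f\,d\nu\}$ over $f:\mathbb{X}\to\mathbb{R}$ with Lipschitz constant at most $1$; for $f:\mathbb{X}\to\mathbb{X}$, $f(\mu)=\mu\circ f^{-1}$. For $\sigma\in\Omega$, $$\tilde{\mathcal{F}}(\sigma)=\lim_{k\to\infty}\ \sum_{i=i_1\cdots i_k\in T}p_{i_1}^{\sigma(\emptyset)}p_{i_2}^{\sigma(i_1)}\cdots p_{i_k}^{\sigma(i_1\cdots i_{k-1})}\;f_{i_1}^{\sigma(\emptyset)}\circ f_{i_2}^{\sigma(i_1)}\circ\cdots\circ f_{i_k}^{\sigma(i_1\cdots i_{k-1})}(\varsigma),$$ the limit existing in the Monge–Kantorovitch metric and being independent of $\varsigma\in\mathbb{P}(\mathbb{X})$; $\tilde{\mathcal{F}}$ is continuous. The IFSs $\Phi$ and $\tilde{\mathcal{F}}_V$. $\mathcal{A}=\{\{1,\dots,N\}\times\{1,\dots,V\}^M\}^V$; write $a=(a_1,\dots,a_V)\in\mathcal{A}$ with $a_v=(n_v;v_{v,1},\dots,v_{v,M})$. $\{\mathcal{P}^a\}_{a\in\mathcal{A}}$ are probabilities ($\mathcal P^a\ge0$, $\sum_a\mathcal P^a=1$). Define $\xi_n:\Omega^M\to\Omega$ by $(\xi_n(\omega))(\emptyset)=n$, $(\xi_n(\omega))(mi)=\omega_m(i)$ for $i\in T$, $m\in\{1,\dots,M\}$. For $a\in\mathcal{A}$, $\eta^a:\Omega^V\to\Omega^V$ is the map whose $v$-th component at $(\omega_1,\dots,\omega_V)$ is $\xi_{n_v}(\omega_{v_{v,1}},\dots,\omega_{v_{v,M}})$,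 and $f^a:\mathbb{P}^V\to\mathbb{P}^V$ is the map whose $v$-th component at $(\mu_1,\dots,\mu_V)$ is $\sum_{m=1}^M p_m^{n_v}f_m^{n_v}(\mu_{v_{v,m}})$. Both $\Phi=\{\Omega^V;\eta^a,\mathcal{P}^a,a\in\mathcal{A}\}$ and $\tilde{\mathcal{F}}_V=\{\mathbb{P}^V;f^a,\mathcal{P}^a,a\in\mathcal{A}\}$ (maximum metric on $\mathbb{P}^V$) are IFSs of contractions. $\Omega_V,\mu_V$ are the set and measure attractors of $\Phi$; $\tilde{\mathfrak{H}}_V,\tilde{\mathfrak{P}}_V$ are those of $\tilde{\mathcal{F}}_V$. $\Omega_{V,1}$ and $\tilde{\mathfrak{H}}_{V,1}$ are the sets of first components of elements of $\Omega_V$ and $\tilde{\mathfrak{H}}_V$. The marginals are $\rho_V(B)=\mu_V(B\times\Omega\times\cdots\times\Omega)$ for Borel $B\subset\Omega$ and $\tilde{\mathfrak{P}}_{V,1}(B)=\tilde{\mathfrak{P}}_V(B\times\mathbb{P}\times\cdots\times\mathbb{P})$ for Borel $B\subset\mathbb{P}$. *)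

theory Defs
  imports "HOL-Probability.Probability"
begin

section \<open>Borel probability measures on a metric space\<close>

definition borel_of_metric :: "'a metric \<Rightarrow> 'a measure" where
  "borel_of_metric m = sigma (mspace m) {U. openin (mtopology_of m) U}"

definition borel_prob_measures :: "'a metric \<Rightarrow> 'a measure set" where
  "borel_prob_measures m = {\<mu>. prob_space \<mu> \<and> sets \<mu> = sets (borel_of_metric m)}"

definition lipschitz1 :: "'a metric \<Rightarrow> ('a \<Rightarrow> real) \<Rightarrow> bool" where
  "lipschitz1 m f \<longleftrightarrow> (\<forall>x\<in>mspace m. \<forall>y\<in>mspace m. \<bar>f x - f y\<bar> \<le> mdist m x y)"

text \<open>The value \<open>0\<close> off the carrier is immaterial, but it is needed because
  \<^locale>\<open>Metric_space\<close> demands nonnegativity of the distance everywhere.\<close>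

definition MK_dist :: "'a metric \<Rightarrow> 'a measure \<Rightarrow> 'a measure \<Rightarrow> real" where
  "MK_dist m \<mu> \<nu> =
     (if \<mu> \<in> borel_prob_measures m \<and> \<nu> \<in> borel_prob_measures m
      then Sup {integral\<^sup>L \<mu> f - integral\<^sup>L \<nu> f | f. lipschitz1 m f} else 0)"

definition MK_metric :: "'a metric \<Rightarrow> 'a measure metric" where
  "MK_metric m = metric (borel_prob_measures m, MK_dist m)"

text \<open>The finite linear combination \<open>\<Sum>i\<in>I. w i * \<mu> i\<close> of Borel measures on \<open>m\<close>.\<close>

definition weighted_sum ::
    "'a metric \<Rightarrow> 'i set \<Rightarrow> ('i \<Rightarrow> real) \<Rightarrow> ('i \<Rightarrow> 'a measure) \<Rightarrow> 'a measure" where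
  "weighted_sum m I w \<mu> =
     measure_of (mspace m) (sets (borel_of_metric m))
       (\<lambda>B. \<Sum>i\<in>I. ennreal (w i) * emeasure (\<mu> i) B)"

abbreviation push_forward :: "'b metric \<Rightarrow> ('a \<Rightarrow> 'b) \<Rightarrow> 'a measure \<Rightarrow> 'b measure" where
  "push_forward m g \<mu> \<equiv> distr \<mu> (borel_of_metric m) g"

section \<open>Finite powers with the maximum metric\<close>

definition power_metric :: "nat \<Rightarrow> 'a metric \<Rightarrow> (nat \<Rightarrow> 'a) metric" where
  "power_metric V m =
     metric ({1..V} \<rightarrow>\<^sub>E mspace m, \<lambda>x y. Max ((\<lambda>v. mdist m (x v) (y v)) ` {1..V}))"

section \<open>Attractors of an IFS with maps \<open>g a\<close> and probabilities \<open>w a\<close>, \<open>a \<in> I\<close>\<close>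

definition set_attractor :: "'y metric \<Rightarrow> 'i set \<Rightarrow> ('i \<Rightarrow> 'y \<Rightarrow> 'y) \<Rightarrow> 'y set" where
  "set_attractor m I g =
     (THE A. A \<noteq> {} \<and> compactin (mtopology_of m) A \<and> A = (\<Union>a\<in>I. g a ` A))"

definition measure_attractor ::
    "'y metric \<Rightarrow> 'i set \<Rightarrow> ('i \<Rightarrow> 'y \<Rightarrow> 'y) \<Rightarrow> ('i \<Rightarrow> real) \<Rightarrow> 'y measure" where
  "measure_attractor m I g w =
     (THE \<mu>. \<mu> \<in> borel_prob_measures m \<and>
             \<mu> = weighted_sum m I w (\<lambda>a. push_forward m (g a) \<mu>))"

section \<open>Code trees\<close>

type_synonym code_tree = "nat list \<Rightarrow> nat"

definition code_trees :: "nat \<Rightarrow> nat \<Rightarrow> code_tree set" where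
  "code_trees M N = lists {1..M} \<rightarrow>\<^sub>E {1..N}"

definition code_tree_dist :: "nat \<Rightarrow> code_tree \<Rightarrow> code_tree \<Rightarrow> real" where
  "code_tree_dist M \<omega> \<kappa> =
     (if \<omega> = \<kappa> then 0
      else 1 / real M ^ (LEAST k. \<exists>i\<in>lists {1..M}. length i = k \<and> \<omega> i \<noteq> \<kappa> i))"

definition code_tree_metric :: "nat \<Rightarrow> nat \<Rightarrow> code_tree metric" where
  "code_tree_metric M N = metric (code_trees M N, code_tree_dist M)"

text \<open>Throughout, \<open>f n m\<close> and \<open>p n m\<close> stand for \<open>f\<close> and \<open>p\<close> with superscript \<open>n\<close> and
  subscript \<open>m\<close>. The letters of a word \<open>i\<close> are \<open>i ! 0\<close>, \<open>i ! 1\<close>, etc., and the letter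
  \<open>i ! j\<close> is governed by the label of the code tree at the node \<open>take j i\<close>.\<close>

definition path_weight ::
    "(nat \<Rightarrow> nat \<Rightarrow> real) \<Rightarrow> code_tree \<Rightarrow> nat list \<Rightarrow> real" where
  "path_weight p \<sigma> i = (\<Prod>j<length i. p (\<sigma> (take j i)) (i ! j))"

definition path_map ::
    "(nat \<Rightarrow> nat \<Rightarrow> 'a \<Rightarrow> 'a) \<Rightarrow> code_tree \<Rightarrow> nat list \<Rightarrow> 'a \<Rightarrow> 'a" where
  "path_map f \<sigma> i = foldr (\<lambda>j g. f (\<sigma> (take j i)) (i ! j) \<circ> g) [0..<length i] id"

definition tree_approx ::
    "'a metric \<Rightarrow> nat \<Rightarrow> (nat \<Rightarrow> nat \<Rightarrow> 'a \<Rightarrow> 'a) \<Rightarrow> (nat \<Rightarrow> nat \<Rightarrow> real) \<Rightarrow>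
     code_tree \<Rightarrow> 'a measure \<Rightarrow> nat \<Rightarrow> 'a measure" where
  "tree_approx X M f p \<sigma> \<zeta> k =
     weighted_sum X {i \<in> lists {1..M}. length i = k} (path_weight p \<sigma>)
       (\<lambda>i. push_forward X (path_map f \<sigma> i) \<zeta>)"

definition tree_measure ::
    "'a metric \<Rightarrow> nat \<Rightarrow> (nat \<Rightarrow> nat \<Rightarrow> 'a \<Rightarrow> 'a) \<Rightarrow> (nat \<Rightarrow> nat \<Rightarrow> real) \<Rightarrow>
     code_tree \<Rightarrow> 'a measure" where
  "tree_measure X M f p \<sigma> =
     (THE \<mu>. \<forall>\<zeta> \<in> borel_prob_measures X.
        limitin (mtopology_of (MK_metric X)) (tree_approx X M f p \<sigma> \<zeta>) \<mu> sequentially)"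

definition tree_measures ::
    "'a metric \<Rightarrow> nat \<Rightarrow> nat \<Rightarrow> (nat \<Rightarrow> nat \<Rightarrow> 'a \<Rightarrow> 'a) \<Rightarrow> (nat \<Rightarrow> nat \<Rightarrow> real) \<Rightarrow>
     (nat \<Rightarrow> code_tree) \<Rightarrow> (nat \<Rightarrow> 'a measure)" where
  "tree_measures X V M f p \<omega> = (\<lambda>v\<in>{1..V}. tree_measure X M f p (\<omega> v))"

section \<open>The two IFSs\<close>

text \<open>An index \<open>a\<close> assigns to each \<open>v\<close> a pair \<open>a v = (n\<^sub>v, u)\<close>, where \<open>u m\<close> is the index
  written with double subscript \<open>v, m\<close>.\<close>

type_synonym ifs_index = "nat \<Rightarrow> nat \<times> (nat \<Rightarrow> nat)"

definition ifs_indices :: "nat \<Rightarrow> nat \<Rightarrow> nat \<Rightarrow> ifs_index set" where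
  "ifs_indices N V M = {1..V} \<rightarrow>\<^sub>E {1..N} \<times> ({1..M} \<rightarrow>\<^sub>E {1..V})"

definition tree_join :: "nat \<Rightarrow> nat \<Rightarrow> (nat \<Rightarrow> code_tree) \<Rightarrow> code_tree" where
  "tree_join M n \<omega> = (\<lambda>i\<in>lists {1..M}. case i of [] \<Rightarrow> n | m # j \<Rightarrow> \<omega> m j)"

definition eta_map ::
    "nat \<Rightarrow> nat \<Rightarrow> ifs_index \<Rightarrow> (nat \<Rightarrow> code_tree) \<Rightarrow> (nat \<Rightarrow> code_tree)" where
  "eta_map V M a \<omega> =
     (\<lambda>v\<in>{1..V}. tree_join M (fst (a v)) (\<lambda>m\<in>{1..M}. \<omega> (snd (a v) m)))"

definition f_map ::
    "'a metric \<Rightarrow> nat \<Rightarrow> nat \<Rightarrow> (nat \<Rightarrow> nat \<Rightarrow> 'a \<Rightarrow> 'a) \<Rightarrow> (nat \<Rightarrow> nat \<Rightarrow> real) \<Rightarrow>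
     ifs_index \<Rightarrow> (nat \<Rightarrow> 'a measure) \<Rightarrow> (nat \<Rightarrow> 'a measure)" where
  "f_map X V M f p a \<mu> =
     (\<lambda>v\<in>{1..V}. weighted_sum X {1..M} (p (fst (a v)))
        (\<lambda>m. push_forward X (f (fst (a v)) m) (\<mu> (snd (a v) m))))"

section \<open>Well-definedness\<close>

text \<open>The pairs passed to \<^const>\<open>metric\<close> above are metric spaces, so that the abstract
  metrics have the intended carriers and distances, and \<^const>\<open>weighted_sum\<close> has the
  intended values.\<close>

lemma space_borel_of_metric [simp]: "space (borel_of_metric m) = mspace m"
  by (simp add: borel_of_metric_def space_measure_of_conv)

lemma sets_borel_of_metric:
  "sets (borel_of_metric m) = sigma_sets (mspace m) {U. openin (mtopology_of m) U}"
  unfolding borel_of_metric_def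
  by (rule sets_measure_of) (use openin_subset in force)

lemma code_tree_Metric_space: 
  assumes "M \<ge> 1"
  shows "Metric_space (code_trees M N) (code_tree_dist M)"
proof
  fix x y :: code_tree
  show "0 \<le> code_tree_dist M x y" by (simp add: code_tree_dist_def)
  show "code_tree_dist M x y = code_tree_dist M y x"
  proof -
    have "(x i \<noteq> y i) = (y i \<noteq> x i)" for i by (rule neq_commute)
    then show ?thesis unfolding code_tree_dist_def by (cases "x = y") simp_all
  qed
  show "code_tree_dist M x y = 0 \<longleftrightarrow> x = y"
    using assms by (simp add: code_tree_dist_def)
next
  fix x y z assume xyz: "x \<in> code_trees M N" "y \<in> code_trees M N" "z \<in> code_trees M N"
  let ?D = "\<lambda>x y k. \<exists>i\<in>lists {1..M}. length i = k \<and> x i \<noteq> y i"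
  have ex: "\<exists>k. ?D a b k" if "a \<in> code_trees M N" "b \<in> code_trees M N" "a \<noteq> b" for a b
    using that PiE_ext[of a "lists {1..M}" _ b] unfolding code_trees_def by blast
  show "code_tree_dist M x z \<le> code_tree_dist M x y + code_tree_dist M y z"
  proof (cases "x = y \<or> y = z \<or> x = z")
    case True
    then show ?thesis by (auto simp: code_tree_dist_def)
  next
    case False
    then have ne: "x \<noteq> y" "y \<noteq> z" "x \<noteq> z" by auto
    have "?D x z (LEAST k. ?D x z k)"
      by (rule LeastI_ex) (use ex[OF xyz(1,3) ne(3)] in simp)
    then have "?D x y (LEAST k. ?D x z k) \<or> ?D y z (LEAST k. ?D x z k)"
      by metis
    then have "(LEAST k. ?D x y k) \<le> (LEAST k. ?D x z k) \<or> (LEAST k. ?D y z k) \<le> (LEAST k. ?D x z k)"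
      by (metis (mono_tags, lifting) Least_le)
    then have "code_tree_dist M x z \<le> code_tree_dist M x y \<or> code_tree_dist M x z \<le> code_tree_dist M y z"
      unfolding code_tree_dist_def using ne assms
      by (auto intro!: divide_left_mono power_increasing)
    moreover have "0 \<le> code_tree_dist M x y" "0 \<le> code_tree_dist M y z"
      by (simp_all add: code_tree_dist_def)
    ultimately show ?thesis by linarith
  qed
qed

lemma power_Metric_space:
  fixes m :: "'a metric" and V :: nat
  assumes "V \<ge> 1"
  shows "Metric_space ({1..V} \<rightarrow>\<^sub>E mspace m) (\<lambda>x y. Max ((\<lambda>v. mdist m (x v) (y v)) ` {1..V}))"
proof
  fix x y :: "nat \<Rightarrow> 'a"
  show "0 \<le> Max ((\<lambda>v. mdist m (x v) (y v)) ` {1..V})"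
    using assms by (subst Max_ge_iff) auto
  show "Max ((\<lambda>v. mdist m (x v) (y v)) ` {1..V}) = Max ((\<lambda>v. mdist m (y v) (x v)) ` {1..V})"
    by (simp add: mdist_commute)
next
  fix x y assume xy: "x \<in> {1..V} \<rightarrow>\<^sub>E mspace m" "y \<in> {1..V} \<rightarrow>\<^sub>E mspace m"
  show "Max ((\<lambda>v. mdist m (x v) (y v)) ` {1..V}) = 0 \<longleftrightarrow> x = y"
  proof
    assume 0: "Max ((\<lambda>v. mdist m (x v) (y v)) ` {1..V}) = 0"
    show "x = y"
    proof (rule PiE_ext[OF xy])
      fix v assume v: "v \<in> {1..V}"
      then have "mdist m (x v) (y v) \<le> 0"
        by (subst 0[symmetric], intro Max_ge) auto
      then show "x v = y v"
        using xy v by (metis PiE_mem antisym mdist_nonneg mdist_zero)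
    qed
  next
    assume "x = y"
    then have "(\<lambda>v. mdist m (x v) (y v)) ` {1..V} = (\<lambda>_. 0) ` {1..V}"
      using xy by (intro image_cong refl) (metis PiE_mem mdist_zero)
    also have "\<dots> = {0}" using assms by (simp add: image_constant_conv)
    finally have "(\<lambda>v. mdist m (x v) (y v)) ` {1..V} = {0}" .
    then show "Max ((\<lambda>v. mdist m (x v) (y v)) ` {1..V}) = 0" by simp
  qed
next
  fix x y z assume xyz: "x \<in> {1..V} \<rightarrow>\<^sub>E mspace m" "y \<in> {1..V} \<rightarrow>\<^sub>E mspace m" "z \<in> {1..V} \<rightarrow>\<^sub>E mspace m"
  show "Max ((\<lambda>v. mdist m (x v) (z v)) ` {1..V}) \<le>
     Max ((\<lambda>v. mdist m (x v) (y v)) ` {1..V}) + Max ((\<lambda>v. mdist m (y v) (z v)) ` {1..V})"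
  proof (rule Max.boundedI)
    fix r assume "r \<in> (\<lambda>v. mdist m (x v) (z v)) ` {1..V}"
    then obtain v where v: "v \<in> {1..V}" "r = mdist m (x v) (z v)" by auto
    then have "r \<le> mdist m (x v) (y v) + mdist m (y v) (z v)"
      using xyz by (auto intro!: mdist_triangle)
    also have "\<dots> \<le> Max ((\<lambda>v. mdist m (x v) (y v)) ` {1..V}) + Max ((\<lambda>v. mdist m (y v) (z v)) ` {1..V})"
      using v by (intro add_mono Max_ge) auto
    finally show "r \<le> \<dots>" .
  qed (use assms in auto)
qed

lemma lipschitz1_measurable:
  assumes "lipschitz1 m f" "\<mu> \<in> borel_prob_measures m"
  shows "f \<in> borel_measurable \<mu>"
proof (rule borel_measurableI)
  fix S :: "real set" assume S: "open S"
  interpret Metric_space "mspace m" "mdist m" by simp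
  have sp: "sets \<mu> = sets (borel_of_metric m)" "space \<mu> = mspace m"
    using assms(2) sets_eq_imp_space_eq[of \<mu> "borel_of_metric m"] by (auto simp: borel_prob_measures_def)
  have "openin mtopology (f -` S \<inter> mspace m)"
    unfolding openin_mtopology
  proof (intro conjI allI impI)
    fix x assume x: "x \<in> f -` S \<inter> mspace m"
    then obtain e where e: "e > 0" "\<And>y. dist y (f x) < e \<Longrightarrow> y \<in> S"
      using S by (auto simp: open_dist)
    have "mball x e \<subseteq> f -` S \<inter> mspace m"
    proof
      fix y assume "y \<in> mball x e"
      then show "y \<in> f -` S \<inter> mspace m"
        using assms(1) e(2)[of "f y"] unfolding lipschitz1_def dist_real_def
        by (simp add: abs_minus_commute) (smt (verit))
    qed
    then show "\<exists>r>0. mball x r \<subseteq> f -` S \<inter> mspace m" using e(1) by blast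
  qed simp
  then show "f -` S \<inter> space \<mu> \<in> sets \<mu>"
    unfolding sp sets_borel_of_metric by (simp add: mtopology_of_def)
qed

lemma lipschitz1_integrable:
  assumes "lipschitz1 m f" "\<mu> \<in> borel_prob_measures m" 
    and D: "\<And>x y. x \<in> mspace m \<Longrightarrow> y \<in> mspace m \<Longrightarrow> mdist m x y \<le> D"
    and x0: "x0 \<in> mspace m"
  shows "integrable \<mu> f" "\<bar>integral\<^sup>L \<mu> f - f x0\<bar> \<le> D"
proof -
  interpret prob_space \<mu> using assms(2) by (simp add: borel_prob_measures_def)
  have sp: "space \<mu> = mspace m"
    using assms(2) sets_eq_imp_space_eq[of \<mu> "borel_of_metric m"] by (auto simp: borel_prob_measures_def)
  have b: "\<bar>f x - f x0\<bar> \<le> D" if "x \<in> space \<mu>" for x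
    using assms(1) that D[of x x0] x0 unfolding lipschitz1_def sp by force
  show int: "integrable \<mu> f"
    by (rule integrable_const_bound[of _ "\<bar>f x0\<bar> + D"])
      (use b lipschitz1_measurable[OF assms(1,2)] in force)+
  have "f x0 - D \<le> integral\<^sup>L \<mu> f" "integral\<^sup>L \<mu> f \<le> f x0 + D"
    using b by (intro integral_ge_const integral_le_const int AE_I2; force)+
  then show "\<bar>integral\<^sup>L \<mu> f - f x0\<bar> \<le> D" by linarith
qed

lemma MK_Metric_space:
  assumes m: "compact_space (mtopology_of m)"
  shows "Metric_space (borel_prob_measures m) (MK_dist m)"
proof -
  interpret Metric_space "mspace m" "mdist m" by simp
  let ?P = "borel_prob_measures m"
  have "mbounded (mspace m)"
    using m compactin_imp_mbounded by (simp add: compact_space_def mtopology_of_def)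
  then obtain D where D: "\<And>x y. x \<in> mspace m \<Longrightarrow> y \<in> mspace m \<Longrightarrow> mdist m x y \<le> D"
    unfolding mbounded_alt by blast
  have sp: "prob_space \<mu>" "sets \<mu> = sets (borel_of_metric m)" "space \<mu> = mspace m" if "\<mu> \<in> ?P" for \<mu>
    using that sets_eq_imp_space_eq[of \<mu> "borel_of_metric m"] by (auto simp: borel_prob_measures_def)
  let ?S = "\<lambda>\<mu> \<nu>. {integral\<^sup>L \<mu> f - integral\<^sup>L \<nu> f | f. lipschitz1 m f}"
  have nonempty: "\<exists>x0. x0 \<in> mspace m" if "\<mu> \<in> ?P" for \<mu>
    using sp[OF that] prob_space.not_empty by fastforce
  have bdd: "bdd_above (?S \<mu> \<nu>)" if P: "\<mu> \<in> ?P" "\<nu> \<in> ?P" for \<mu> \<nu>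
  proof -
    obtain x0 where "x0 \<in> mspace m" using nonempty[OF P(1)] by blast
    then have "integral\<^sup>L \<mu> f - integral\<^sup>L \<nu> f \<le> 2 * D" if "lipschitz1 m f" for f
      using lipschitz1_integrable(2)[OF that _ D, of _ x0] \<open>\<mu> \<in> ?P\<close> \<open>\<nu> \<in> ?P\<close> by (smt (verit))
    then show ?thesis by (auto intro!: bdd_aboveI[of _ "2*D"])
  qed
  have upper: "integral\<^sup>L \<mu> f - integral\<^sup>L \<nu> f \<le> MK_dist m \<mu> \<nu>" 
    if "\<mu> \<in> ?P" "\<nu> \<in> ?P" "lipschitz1 m f" for \<mu> \<nu> f
    using that by (auto simp: MK_dist_def intro!: cSup_upper bdd)
  have lip0: "lipschitz1 m (\<lambda>_. 0)" by (simp add: lipschitz1_def)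
  have least: "MK_dist m \<mu> \<nu> \<le> c" 
    if "\<mu> \<in> ?P" "\<nu> \<in> ?P" "\<And>f. lipschitz1 m f \<Longrightarrow> integral\<^sup>L \<mu> f - integral\<^sup>L \<nu> f \<le> c" for \<mu> \<nu> c
    using that lip0 by (auto simp: MK_dist_def intro!: cSup_least)
  have lip_minus: "lipschitz1 m (\<lambda>x. - f x)" if "lipschitz1 m f" for f
    using that by (auto simp: lipschitz1_def abs_minus_commute)
  have half: "MK_dist m \<mu> \<nu> \<le> MK_dist m \<nu> \<mu>" if "\<mu> \<in> ?P" "\<nu> \<in> ?P" for \<mu> \<nu>
    by (rule least[OF that]) (use upper[OF that(2,1)] lip_minus in force)
  have ident: "\<mu> = \<nu>" if P: "\<mu> \<in> ?P" "\<nu> \<in> ?P" and 0: "MK_dist m \<mu> \<nu> = 0" for \<mu> \<nu>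
  proof -
    have z': "MK_dist m \<nu> \<mu> = 0" using half P 0 upper[OF P(2,1) lip0] by force
    have eq: "integral\<^sup>L \<mu> f = integral\<^sup>L \<nu> f" if "lipschitz1 m f" for f
      using upper[OF P that] upper[OF P(2,1) that] 0 z' by linarith
    interpret \<mu>: prob_space \<mu> using sp P by blast
    interpret \<nu>: prob_space \<nu> using sp P by blast
    have closed: "emeasure \<mu> (mspace m - U) = emeasure \<nu> (mspace m - U)" if U: "openin mtopology U" for U
    proof (cases "mspace m - U = {}")
      case True then show ?thesis by (metis emeasure_empty)
    next
      case False
      define C where "C = mspace m - U"
      define d where "d x = Inf ((\<lambda>y. mdist m x y) ` C)" for x
      have C: "C \<noteq> {}" "C \<subseteq> mspace m" using False by (auto simp: C_def)
      have bb: "bdd_below ((\<lambda>y. mdist m x y) ` C)" for x by (auto intro!: bdd_belowI[of _ 0])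
      have d0: "0 \<le> d x" for x unfolding d_def using C by (auto intro!: cINF_greatest)
      have dle: "d x \<le> d y + mdist m x y" if "x \<in> mspace m" "y \<in> mspace m" for x y
      proof -
        have "d x - mdist m x y \<le> d y"
          unfolding d_def[of y] 
        proof (rule cINF_greatest[OF C(1)])
          fix c assume c: "c \<in> C"
          then have "d x \<le> mdist m x c" unfolding d_def using bb by (auto intro: cINF_lower)
          also have "\<dots> \<le> mdist m x y + mdist m y c" using c C that by (auto intro!: mdist_triangle)
          finally show "d x - mdist m x y \<le> mdist m y c" by simp
        qed
        then show ?thesis by simp
      qed
      have dC: "d x = 0" if "x \<in> C" for x
      proof -
        have "d x \<le> mdist m x x" unfolding d_def using that bb by (auto intro: cINF_lower)
        then show ?thesis using that C d0[of x] by force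
      qed
      have dU: "d x > 0" if "x \<in> mspace m" "x \<notin> C" for x
      proof -
        have "x \<in> U" using that by (auto simp: C_def)
        then obtain r where r: "r > 0" "mball x r \<subseteq> U" using U unfolding openin_mtopology by blast
        have "r \<le> d x" unfolding d_def
        proof (rule cINF_greatest[OF C(1)])
          fix c assume "c \<in> C"
          then show "r \<le> mdist m x c" using r C that unfolding C_def by (force simp: subset_iff)
        qed
        then show ?thesis using r by linarith
      qed
      define g where "g n x = max 0 (1 - real n * d x)" for n x
      have lim: "(\<lambda>n. g n x) \<longlonglongrightarrow> indicator C x" if "x \<in> mspace m" for x
      proof (cases "x \<in> C")
        case True then show ?thesis by (simp add: g_def dC)
      next
        case False
        with that have "d x > 0" using dU by blast
        then obtain k where k: "1 < real k * d x" using reals_Archimedean3 by blast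
        have "\<forall>\<^sub>F n in sequentially. g n x = 0"
          unfolding eventually_sequentially g_def
        proof (intro exI allI impI)
          fix n assume "k \<le> n"
          then have "real k * d x \<le> real n * d x" using d0[of x] by (intro mult_right_mono) auto
          then show "max 0 (1 - real n * d x) = 0" using k by linarith
        qed
        then show ?thesis using False by (simp add: tendsto_eventually)
      qed
      have lipg: "lipschitz1 m (\<lambda>x. g (Suc n) x / real (Suc n))" for n
        unfolding lipschitz1_def
      proof (intro ballI)
        fix x y assume xy: "x \<in> mspace m" "y \<in> mspace m"
        have "\<bar>d x - d y\<bar> \<le> mdist m x y" using dle[OF xy] dle[OF xy(2,1)] by (simp add: mdist_commute)
        have "\<bar>g (Suc n) x - g (Suc n) y\<bar> \<le> \<bar>real (Suc n) * d x - real (Suc n) * d y\<bar>"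
          unfolding g_def by linarith
        also have "\<dots> = real (Suc n) * \<bar>d x - d y\<bar>" by (simp add: abs_mult right_diff_distrib[symmetric])
        also have "\<dots> \<le> real (Suc n) * mdist m x y" using \<open>\<bar>d x - d y\<bar> \<le> _\<close> by (intro mult_left_mono) auto
        finally show "\<bar>g (Suc n) x / real (Suc n) - g (Suc n) y / real (Suc n)\<bar> \<le> mdist m x y"
          by (simp add: diff_divide_distrib[symmetric] divide_le_eq mult.commute)
      qed
      have eqg: "integral\<^sup>L \<mu> (g (Suc n)) = integral\<^sup>L \<nu> (g (Suc n))" for n
        using eq[OF lipg[of n]] by simp
      have Cs: "C \<in> sets (borel_of_metric m)"
      proof -
        have "U \<in> sets (borel_of_metric m)" using U by (simp add: sets_borel_of_metric mtopology_of_def)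
        then show ?thesis unfolding C_def by (metis sets.compl_sets space_borel_of_metric)
      qed
      have conv: "(\<lambda>n. integral\<^sup>L \<kappa> (g (Suc n))) \<longlonglongrightarrow> measure \<kappa> C" if k: "\<kappa> \<in> ?P" for \<kappa>
      proof -
        interpret prob_space \<kappa> using sp k by blast
        have meas: "g (Suc n) \<in> borel_measurable \<kappa>" for n
        proof -
          have "(\<lambda>x. real (Suc n) * (g (Suc n) x / real (Suc n))) \<in> borel_measurable \<kappa>"
            using lipschitz1_measurable[OF lipg k, of n] by (intro borel_measurable_times) auto
          then show ?thesis by (simp del: of_nat_Suc)
        qed
        have "(\<lambda>n. integral\<^sup>L \<kappa> (g (Suc n))) \<longlonglongrightarrow> integral\<^sup>L \<kappa> (indicator C)"
        proof (rule integral_dominated_convergence[where w="\<lambda>_. 1"])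
          show "AE x in \<kappa>. (\<lambda>n. g (Suc n) x) \<longlonglongrightarrow> indicator C x"
            using lim sp(3)[OF k] by (intro AE_I2 LIMSEQ_Suc) auto
          show "\<And>n. AE x in \<kappa>. norm (g (Suc n) x) \<le> 1"
            using d0 by (intro AE_I2) (auto simp: g_def)
          show "indicator C \<in> borel_measurable \<kappa>" using Cs sp(2)[OF k] by (intro borel_measurable_indicator) auto
        qed (use meas in auto)
        also have "integral\<^sup>L \<kappa> (indicator C) = measure \<kappa> C"
          using C sp(3)[OF k] by (simp add: Int_absorb2)
        finally show ?thesis .
      qed
      have "measure \<mu> C = measure \<nu> C"
        using conv[OF P(1)] conv[OF P(2)] unfolding eqg by (rule LIMSEQ_unique)
      then show ?thesis unfolding C_def by (simp add: \<mu>.emeasure_eq_measure \<nu>.emeasure_eq_measure)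
    qed
    have op: "emeasure \<mu> U = emeasure \<nu> U" if U: "openin mtopology U" for U
    proof -
      have Us: "U \<in> sets (borel_of_metric m)" "U \<subseteq> mspace m"
        using U openin_subset[OF U] by (auto simp: sets_borel_of_metric mtopology_of_def)
      have Cs: "mspace m - U \<in> sets (borel_of_metric m)"
        using Us(1) by (metis sets.compl_sets space_borel_of_metric)
      have "measure \<mu> (mspace m - U) = measure \<nu> (mspace m - U)"
        using closed[OF U] by (simp add: measure_def)
      then have "measure \<mu> U = measure \<nu> U"
        using \<mu>.prob_compl[of U] \<nu>.prob_compl[of U] Us sp[OF P(1)] sp[OF P(2)] by simp
      then show ?thesis by (simp add: \<mu>.emeasure_eq_measure \<nu>.emeasure_eq_measure)
    qed
    show ?thesis
    proof (rule measure_eqI_generator_eq[where \<Omega>="mspace m" and E="{U. openin mtopology U}" and A="\<lambda>_. mspace m"])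
      show "Int_stable {U. openin mtopology U}" by (auto simp: Int_stable_def)
      show "{U. openin mtopology U} \<subseteq> Pow (mspace m)" using openin_subset by force
      show "emeasure \<mu> U = emeasure \<nu> U" if "U \<in> {U. openin mtopology U}" for U
        using op that by simp
      show "sets \<mu> = sigma_sets (mspace m) {U. openin mtopology U}"
        using sp(2)[OF P(1)] by (simp add: sets_borel_of_metric mtopology_of_def)
      show "sets \<nu> = sigma_sets (mspace m) {U. openin mtopology U}"
        using sp(2)[OF P(2)] by (simp add: sets_borel_of_metric mtopology_of_def)
      show "range (\<lambda>_::nat. mspace m) \<subseteq> {U. openin mtopology U}" by auto
      show "(\<Union>i::nat. mspace m) = mspace m" by simp
      show "emeasure \<mu> (mspace m) \<noteq> \<infinity>" by simp
    qed
  qed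
  show ?thesis
  proof
    fix \<mu> \<nu>
    show "0 \<le> MK_dist m \<mu> \<nu>"
      using upper[OF _ _ lip0, of \<mu> \<nu>] by (cases "\<mu> \<in> ?P \<and> \<nu> \<in> ?P") (auto simp: MK_dist_def)
    show "MK_dist m \<mu> \<nu> = MK_dist m \<nu> \<mu>"
      using half[of \<mu> \<nu>] half[of \<nu> \<mu>] by (cases "\<mu> \<in> ?P \<and> \<nu> \<in> ?P") (auto simp: MK_dist_def)
  next
    fix \<mu> \<nu> assume "\<mu> \<in> ?P" "\<nu> \<in> ?P"
    moreover have "MK_dist m \<mu> \<mu> = 0"
      using least[of \<mu> \<mu> 0] upper[OF _ _ lip0, of \<mu> \<mu>] \<open>\<mu> \<in> ?P\<close> by force
    ultimately show "MK_dist m \<mu> \<nu> = 0 \<longleftrightarrow> \<mu> = \<nu>" using ident by blast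
  next
    fix \<mu> \<nu> \<kappa> assume P: "\<mu> \<in> ?P" "\<nu> \<in> ?P" "\<kappa> \<in> ?P"
    show "MK_dist m \<mu> \<kappa> \<le> MK_dist m \<mu> \<nu> + MK_dist m \<nu> \<kappa>"
      by (rule least[OF P(1,3)]) (use upper[OF P(1,2)] upper[OF P(2,3)] in fastforce)
  qed
qed

lemma emeasure_weighted_sum:
  assumes I: "finite I" and \<mu>: "\<And>i. i \<in> I \<Longrightarrow> sets (\<mu> i) = sets (borel_of_metric m)"
    and B: "B \<in> sets (borel_of_metric m)"
  shows "emeasure (weighted_sum m I w \<mu>) B = (\<Sum>i\<in>I. ennreal (w i) * emeasure (\<mu> i) B)"
  unfolding weighted_sum_def
proof (rule emeasure_measure_of_sigma)
  show "sigma_algebra (mspace m) (sets (borel_of_metric m))"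
    by (metis sets.sigma_algebra_axioms space_borel_of_metric)
  show "positive (sets (borel_of_metric m)) (\<lambda>B. \<Sum>i\<in>I. ennreal (w i) * emeasure (\<mu> i) B)"
    by (simp add: positive_def)
  show "countably_additive (sets (borel_of_metric m)) (\<lambda>B. \<Sum>i\<in>I. ennreal (w i) * emeasure (\<mu> i) B)"
  proof (rule countably_additiveI)
    fix A :: "nat \<Rightarrow> _" assume A: "range A \<subseteq> sets (borel_of_metric m)" "disjoint_family A"
    have "(\<Sum>k. \<Sum>i\<in>I. ennreal (w i) * emeasure (\<mu> i) (A k)) = (\<Sum>i\<in>I. \<Sum>k. ennreal (w i) * emeasure (\<mu> i) (A k))"
      by (rule suminf_sum) simp
    also have "\<dots> = (\<Sum>i\<in>I. ennreal (w i) * emeasure (\<mu> i) (\<Union>k. A k))"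
      using A \<mu> by (intro sum.cong) (auto simp: suminf_emeasure)
    finally show "(\<Sum>k. \<Sum>i\<in>I. ennreal (w i) * emeasure (\<mu> i) (A k)) = (\<Sum>i\<in>I. ennreal (w i) * emeasure (\<mu> i) (\<Union>k. A k))" .
  qed
qed (use B in auto)

lemma MK_metric_simps:
  assumes "compact_space (mtopology_of m)"
  shows "mspace (MK_metric m) = borel_prob_measures m" "mdist (MK_metric m) = MK_dist m"
  using MK_Metric_space[OF assms]
  by (simp_all add: MK_metric_def Metric_space.mspace_metric Metric_space.mdist_metric)

lemma power_metric_simps:
  assumes "V \<ge> 1"
  shows "mspace (power_metric V m) = {1..V} \<rightarrow>\<^sub>E mspace m"
    and "mdist (power_metric V m) = (\<lambda>x y. Max ((\<lambda>v. mdist m (x v) (y v)) ` {1..V}))"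
  using power_Metric_space[OF assms, of m]
  by (simp_all add: power_metric_def Metric_space.mspace_metric Metric_space.mdist_metric)

lemma code_tree_metric_simps:
  assumes "M \<ge> 1"
  shows "mspace (code_tree_metric M N) = code_trees M N"
    and "mdist (code_tree_metric M N) = code_tree_dist M"
  using code_tree_Metric_space[OF assms, of N]
  by (simp_all add: code_tree_metric_def Metric_space.mspace_metric Metric_space.mdist_metric)

end

theory Submission
  imports Defs
begin

text \<open>Attractors of an IFS of contractions on a bounded metric space are unique, for sets by
  iterating the invariance and for measures because the Markov operator contracts the
  Monge--Kantorovitch distance. Hence it suffices to construct the attractors of \<open>\<Phi>\<close> and to
  transport them by the continuous map \<open>F\<^sub>V\<close>, which intertwines \<open>\<eta>\<^sup>a\<close> and \<open>f\<^sup>a\<close>; neither the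
  completeness nor the compactness of the space of probability measures is used.

  Existence comes from addresses: a point is read off a stream of letters, each of which applies a
  contraction and changes the state. With trivial states and letters in \<open>\<A>\<close> the image
  of all streams is the set attractor of \<open>\<Phi>\<close> and the law of an i.i.d. stream its measure attractor.
  With code trees as states, the law \<open>L \<sigma>\<close> of the point addressed from \<open>\<sigma>\<close> satisfies
  \<open>L \<sigma> = \<Sum>\<^sub>m p\<^sub>m f\<^sub>m (L \<sigma>\<^sub>m)\<close>, where \<open>\<sigma>\<^sub>m\<close> is the \<open>m\<close>-th subtree of \<open>\<sigma>\<close>. The approximations
  in the definition of the measure of \<open>\<sigma>\<close> obey the same recursion, so they converge to \<open>L \<sigma>\<close>.\<close>

section \<open>Borel probability measures on bounded metric spaces\<close>

text \<open>The measure of a code tree is a definite description of a limit, so nothing can be said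
  about it before a limit is exhibited. It is found as the distribution of a random point of
  \<open>X\<close>, where limits of points are available from compactness, and only afterwards
  compared with the approximations. The difficulty is that the maps applied depend on the labels met
  in the tree, while one source of randomness must serve all trees: the recursion relates the law of
  a tree to the laws of its subtrees, which therefore have to be produced by the same stream. Once
  the recursion is known, the intertwining relation is nothing but its reading at the root of each
  joined tree.

  On measures, a contraction is estimated by dividing a test function by the Lipschitz constant.
  That constant must be positive although \<open>l\<close> may vanish, so it is enlarged before use.

  Measures on tuples of measures live on the Borel sets of the maximum metric. Marginals are
  push-forwards along a coordinate, which is 1-Lipschitz and hence measurable for these
  sets.\<close>

text \<open>The bound is carried as a number because it becomes the factor in front of all geometric
  rates.\<close>

definition diam_le :: "'a metric \<Rightarrow> real \<Rightarrow> bool" where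
  "diam_le m D \<longleftrightarrow> (\<forall>x\<in>mspace m. \<forall>y\<in>mspace m. mdist m x y \<le> D)"

lemma borel_prob_measuresD:
  assumes "\<mu> \<in> borel_prob_measures m"
  shows "prob_space \<mu>" "sets \<mu> = sets (borel_of_metric m)" "space \<mu> = mspace m"
  using assms sets_eq_imp_space_eq[of \<mu> "borel_of_metric m"]
  by (auto simp: borel_prob_measures_def)

lemma borel_prob_measures_nonempty:
  assumes "\<mu> \<in> borel_prob_measures m"
  obtains x where "x \<in> mspace m"
  using borel_prob_measuresD[OF assms] prob_space.not_empty by fastforce

lemma openin_borel_of_metric:
  "openin (mtopology_of m) U \<Longrightarrow> U \<in> sets (borel_of_metric m)"
  by (simp add: sets_borel_of_metric)

lemma measurable_borel_of_metricI:
  assumes "f \<in> space N \<rightarrow> mspace m"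
    and "\<And>U. openin (mtopology_of m) U \<Longrightarrow> f -` U \<inter> space N \<in> sets N"
  shows "f \<in> measurable N (borel_of_metric m)"
  unfolding borel_of_metric_def
  by (rule measurable_measure_of) (use assms openin_subset in \<open>force+\<close>)

lemma continuous_map_borel_measurable:
  assumes "continuous_map (mtopology_of m) (mtopology_of m') f"
  shows "f \<in> measurable (borel_of_metric m) (borel_of_metric m')"
proof (rule measurable_borel_of_metricI)
  show "f \<in> space (borel_of_metric m) \<rightarrow> mspace m'"
    using continuous_map_funspace[OF assms] by simp
  fix U assume "openin (mtopology_of m') U"
  then have "openin (mtopology_of m) {x \<in> topspace (mtopology_of m). f x \<in> U}"
    using assms by (rule openin_continuous_map_preimage[rotated])
  then show "f -` U \<inter> space (borel_of_metric m) \<in> sets (borel_of_metric m)"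
    by (auto dest!: openin_borel_of_metric simp: vimage_def Int_def conj_commute)
qed

lemma lipschitz_continuous_map:
  assumes "f \<in> mspace m \<rightarrow> mspace m'"
    and "\<And>x y. x \<in> mspace m \<Longrightarrow> y \<in> mspace m \<Longrightarrow> mdist m' (f x) (f y) \<le> c * mdist m x y"
  shows "continuous_map (mtopology_of m) (mtopology_of m') f"
  using assms by (intro Lipschitz_continuous_imp_continuous_map)
    (auto simp: Lipschitz_continuous_map_def)

lemma continuous_map_mtopology_of:
  assumes "f \<in> mspace m \<rightarrow> mspace m'"
    and "\<And>x e. x \<in> mspace m \<Longrightarrow> e > 0 \<Longrightarrow>
           \<exists>d>0. \<forall>y\<in>mspace m. mdist m x y < d \<longrightarrow> mdist m' (f x) (f y) < e"
  shows "continuous_map (mtopology_of m) (mtopology_of m') f"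
proof -
  interpret m: Metric_space "mspace m" "mdist m" by simp
  interpret m': Metric_space "mspace m'" "mdist m'" by simp
  show ?thesis
    unfolding mtopology_of_def m'.continuous_map_to_metric
  proof (intro ballI allI impI)
    fix x and e :: real assume x: "x \<in> topspace m.mtopology" and e: "e > 0"
    then obtain d where d: "d > 0" "\<forall>y\<in>mspace m. mdist m x y < d \<longrightarrow> mdist m' (f x) (f y) < e"
      using assms(2)[of x e] by auto
    show "\<exists>U. openin m.mtopology U \<and> x \<in> U \<and> (\<forall>y\<in>U. f y \<in> m'.mball (f x) e)"
      by (intro exI[of _ "m.mball x d"]) (use x d assms(1) in auto)
  qed
qed

lemma push_forward_in_borel_prob_measures:
  assumes "\<mu> \<in> borel_prob_measures m" "f \<in> measurable (borel_of_metric m) (borel_of_metric m')"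
  shows "push_forward m' f \<mu> \<in> borel_prob_measures m'"
proof -
  have "f \<in> measurable \<mu> (borel_of_metric m')"
    using assms borel_prob_measuresD(2)[OF assms(1)] by (simp cong: measurable_cong_sets)
  then show ?thesis
    using prob_space.prob_space_distr[OF borel_prob_measuresD(1)[OF assms(1)]]
    by (simp add: borel_prob_measures_def)
qed

text \<open>The indicator of a closed set \<open>C\<close> is the pointwise limit of multiples of Lipschitz functions
  of the distance to \<open>C\<close>. Compactness is avoided because the lemma is needed on the space
  of tuples of measures, whose compactness is never established.\<close>

lemma borel_prob_measures_eqI:
  assumes P: "\<mu> \<in> borel_prob_measures m" "\<nu> \<in> borel_prob_measures m"
    and eq: "\<And>h. lipschitz1 m h \<Longrightarrow> integral\<^sup>L \<mu> h = integral\<^sup>L \<nu> h"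
  shows "\<mu> = \<nu>"
proof -
  interpret Metric_space "mspace m" "mdist m" by simp
  interpret \<mu>: prob_space \<mu> by (rule borel_prob_measuresD(1)[OF P(1)])
  interpret \<nu>: prob_space \<nu> by (rule borel_prob_measuresD(1)[OF P(2)])
  have closed: "measure \<mu> C = measure \<nu> C"
    if C: "C \<noteq> {}" "C \<subseteq> mspace m" "openin mtopology (mspace m - C)" for C
  proof -
    define d where "d x = Inf (mdist m x ` C)" for x
    have bb: "bdd_below (mdist m x ` C)" for x by (auto intro!: bdd_belowI[of _ 0])
    have d0: "0 \<le> d x" for x unfolding d_def using C by (auto intro!: cINF_greatest)
    have dle: "d x \<le> d y + mdist m x y" if xy: "x \<in> mspace m" "y \<in> mspace m" for x y
    proof -
      have "d x - mdist m x y \<le> mdist m y c" if "c \<in> C" for c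
      proof -
        have "d x \<le> mdist m x c" unfolding d_def by (rule cINF_lower[OF bb that])
        also have "\<dots> \<le> mdist m x y + mdist m y c" using C xy that by (intro mdist_triangle) auto
        finally show ?thesis by simp
      qed
      then have "d x - mdist m x y \<le> d y" unfolding d_def[of y] using C by (intro cINF_greatest)
      then show ?thesis by simp
    qed
    \<comment> \<open>A tent of slope n + 1: it is 1 on \<open>C\<close> and vanishes at distance at
      least 1 / (n + 1) from \<open>C\<close>. Dividing by the slope gives the 1-Lipschitz functions
      to which \<open>eq\<close> applies.\<close>
    define g where "g n x = max 0 (1 - real (Suc n) * d x)" for n x
    have lim: "(\<lambda>n. g n x) \<longlonglongrightarrow> indicator C x" if x: "x \<in> mspace m" for x
    proof (cases "x \<in> C")
      case True
      then have "d x \<le> mdist m x x" unfolding d_def by (rule cINF_lower[OF bb])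
      then have "d x = 0" using d0[of x] x by simp
      then show ?thesis using True by (simp add: g_def)
    next
      case False
      then obtain r where r: "r > 0" "mball x r \<subseteq> mspace m - C"
        using C(3) x unfolding openin_mtopology by blast
      have "r \<le> mdist m x c" if "c \<in> C" for c
        using r(2) that C(2) x by (smt (verit) DiffE in_mball subsetD)
      then have "r \<le> d x" unfolding d_def using C by (intro cINF_greatest)
      then have "d x > 0" using r by simp
      then obtain k where k: "1 < real k * d x" using reals_Archimedean3 by blast
      have "\<forall>\<^sub>F n in sequentially. g n x = 0"
        unfolding eventually_sequentially
      proof (intro exI allI impI)
        fix n assume "k \<le> n"
        then have "real k * d x \<le> real (Suc n) * d x" using d0[of x] by (intro mult_right_mono) auto
        then show "g n x = 0" using k unfolding g_def by linarith
      qed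
      then show ?thesis using False by (simp add: tendsto_eventually)
    qed
    have lip: "lipschitz1 m (\<lambda>x. g n x / real (Suc n))" for n
      unfolding lipschitz1_def
    proof (intro ballI)
      fix x y assume xy: "x \<in> mspace m" "y \<in> mspace m"
      have dd: "\<bar>d x - d y\<bar> \<le> mdist m x y"
        using dle[OF xy] dle[OF xy(2,1)] by (simp add: mdist_commute)
      have "\<bar>g n x - g n y\<bar> \<le> \<bar>real (Suc n) * d x - real (Suc n) * d y\<bar>"
        unfolding g_def by linarith
      also have "\<dots> = real (Suc n) * \<bar>d x - d y\<bar>"
        by (simp add: abs_mult right_diff_distrib[symmetric] del: of_nat_Suc)
      also have "\<dots> \<le> real (Suc n) * mdist m x y" using dd by (intro mult_left_mono) auto
      finally show "\<bar>g n x / real (Suc n) - g n y / real (Suc n)\<bar> \<le> mdist m x y"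
        by (simp add: diff_divide_distrib[symmetric] divide_le_eq mult.commute)
    qed
    have Cs: "C \<in> sets (borel_of_metric m)"
    proof -
      have "mspace m - (mspace m - C) \<in> sets (borel_of_metric m)"
        using sets.compl_sets[OF openin_borel_of_metric[of m "mspace m - C"]] C(3)
        by (simp add: mtopology_of_def)
      then show ?thesis using C(2) by (simp add: double_diff)
    qed
    have conv: "(\<lambda>n. integral\<^sup>L \<kappa> (g n)) \<longlonglongrightarrow> measure \<kappa> C"
      if k: "\<kappa> \<in> borel_prob_measures m" for \<kappa>
    proof -
      note kD = borel_prob_measuresD[OF k]
      interpret prob_space \<kappa> by (rule kD(1))
      have meas: "g n \<in> borel_measurable \<kappa>" for n
      proof -
        have "(\<lambda>x. real (Suc n) * (g n x / real (Suc n))) \<in> borel_measurable \<kappa>"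
          using lipschitz1_measurable[OF lip k, of n] by (intro borel_measurable_times) auto
        then show ?thesis by (simp del: of_nat_Suc)
      qed
      have "(\<lambda>n. integral\<^sup>L \<kappa> (g n)) \<longlonglongrightarrow> integral\<^sup>L \<kappa> (indicator C)"
      proof (rule integral_dominated_convergence[where w="\<lambda>_. 1"])
        show "AE x in \<kappa>. (\<lambda>n. g n x) \<longlonglongrightarrow> indicator C x"
          using lim kD(3) by (intro AE_I2) auto
        show "\<And>n. AE x in \<kappa>. norm (g n x) \<le> 1"
          using d0 by (intro AE_I2) (auto simp: g_def)
        show "indicator C \<in> borel_measurable \<kappa>"
          using Cs kD(2) by (intro borel_measurable_indicator) auto
      qed (use meas in auto)
      also have "integral\<^sup>L \<kappa> (indicator C) = measure \<kappa> C"
        using C kD(3) by (simp add: Int_absorb2)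
      finally show ?thesis .
    qed
    have "integral\<^sup>L \<mu> (g n) = integral\<^sup>L \<nu> (g n)" for n
      using eq[OF lip[of n]] by simp
    then show ?thesis using LIMSEQ_unique[OF conv[OF P(1)]] conv[OF P(2)] by simp
  qed
  show ?thesis
  proof (rule measure_eqI_generator_eq[where \<Omega>="mspace m"
        and E="{U. openin (mtopology_of m) U}" and A="\<lambda>_. mspace m"])
    show "Int_stable {U. openin (mtopology_of m) U}" by (auto simp: Int_stable_def)
    show "{U. openin (mtopology_of m) U} \<subseteq> Pow (mspace m)" using openin_subset by force
    show "emeasure \<mu> U = emeasure \<nu> U" if "U \<in> {U. openin (mtopology_of m) U}" for U
    proof -
      have U: "U \<in> sets (borel_of_metric m)" "U \<subseteq> mspace m" "openin mtopology U"
        using that openin_subset[of "mtopology_of m" U] openin_borel_of_metric[of m U]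
        by (auto simp: mtopology_of_def)
      \<comment> \<open>The distance to an empty set has no meaning, so the case of an empty
        complement is split off.\<close>
      have "measure \<mu> (mspace m - U) = measure \<nu> (mspace m - U)"
        using closed[of "mspace m - U"] U by (cases "mspace m - U = {}") (auto simp: double_diff)
      then have "measure \<mu> U = measure \<nu> U"
        using \<mu>.prob_compl[of U] \<nu>.prob_compl[of U] U
          borel_prob_measuresD[OF P(1)] borel_prob_measuresD[OF P(2)] by simp
      then show ?thesis by (simp add: \<mu>.emeasure_eq_measure \<nu>.emeasure_eq_measure)
    qed
    show "range (\<lambda>_::nat. mspace m) \<subseteq> {U. openin (mtopology_of m) U}"
      using openin_topspace[of "mtopology_of m"] by (auto simp del: openin_topspace)
  qed (use borel_prob_measuresD(2)[OF P(1)] borel_prob_measuresD(2)[OF P(2)]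
      in \<open>auto simp: sets_borel_of_metric\<close>)
qed

section \<open>The Monge--Kantorovitch distance\<close>

text \<open>Boundedness makes the supremum genuine: each integral of a 1-Lipschitz function lies
  within \<open>D\<close> of the value at a base point, so all differences are at most
  \<open>2 * D\<close>.\<close>

lemma MK_dist_upper:
  assumes D: "diam_le m D" and P: "\<mu> \<in> borel_prob_measures m" "\<nu> \<in> borel_prob_measures m"
    and h: "lipschitz1 m h"
  shows "integral\<^sup>L \<mu> h - integral\<^sup>L \<nu> h \<le> MK_dist m \<mu> \<nu>"
proof -
  obtain x0 where x0: "x0 \<in> mspace m" using borel_prob_measures_nonempty[OF P(1)] .
  have "integral\<^sup>L \<mu> k - integral\<^sup>L \<nu> k \<le> 2 * D" if "lipschitz1 m k" for k
    using lipschitz1_integrable(2)[OF that P(1) _ x0, of D]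
      lipschitz1_integrable(2)[OF that P(2) _ x0, of D] D unfolding diam_le_def by (smt (verit))
  then show ?thesis
    using P h by (auto simp: MK_dist_def intro!: cSup_upper bdd_aboveI[of _ "2*D"])
qed

lemma MK_dist_least:
  assumes "\<mu> \<in> borel_prob_measures m" "\<nu> \<in> borel_prob_measures m"
    and "\<And>h. lipschitz1 m h \<Longrightarrow> integral\<^sup>L \<mu> h - integral\<^sup>L \<nu> h \<le> c"
  shows "MK_dist m \<mu> \<nu> \<le> c"
proof -
  have "lipschitz1 m (\<lambda>_. 0)" by (simp add: lipschitz1_def)
  then show ?thesis using assms by (auto simp: MK_dist_def intro!: cSup_least)
qed

text \<open>The comparison through a base point costs the factor 2, which only enters constants in
  front of geometric rates.\<close>

lemma MK_dist_le_diam: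
  assumes D: "diam_le m D" and P: "\<mu> \<in> borel_prob_measures m" "\<nu> \<in> borel_prob_measures m"
  shows "MK_dist m \<mu> \<nu> \<le> 2 * D"
proof (rule MK_dist_least[OF P])
  fix h assume h: "lipschitz1 m h"
  obtain x0 where x0: "x0 \<in> mspace m" using borel_prob_measures_nonempty[OF P(1)] .
  show "integral\<^sup>L \<mu> h - integral\<^sup>L \<nu> h \<le> 2 * D"
    using lipschitz1_integrable(2)[OF h P(1) _ x0, of D]
      lipschitz1_integrable(2)[OF h P(2) _ x0, of D] D unfolding diam_le_def by (smt (verit))
qed

lemma MK_dist_zero_imp_eq:
  assumes D: "diam_le m D" and P: "\<mu> \<in> borel_prob_measures m" "\<nu> \<in> borel_prob_measures m"
    and z: "MK_dist m \<mu> \<nu> \<le> 0"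
  shows "\<mu> = \<nu>"
proof (rule borel_prob_measures_eqI[OF P])
  fix h assume h: "lipschitz1 m h"
  \<comment> \<open>The supremum bounds differences from one side; the test function
    \<open>- h\<close> supplies the other.\<close>
  then have h': "lipschitz1 m (\<lambda>x. - h x)" by (auto simp: lipschitz1_def abs_minus_commute)
  show "integral\<^sup>L \<mu> h = integral\<^sup>L \<nu> h"
    using MK_dist_upper[OF D P h] MK_dist_upper[OF D P h'] z by simp
qed

section \<open>Weighted sums of measures\<close>

lemma space_weighted_sum [simp]: "space (weighted_sum m I w \<mu>) = mspace m"
  by (simp add: weighted_sum_def space_measure_of_conv)

lemma sets_weighted_sum [simp]: "sets (weighted_sum m I w \<mu>) = sets (borel_of_metric m)"
  unfolding weighted_sum_def
  by (metis sets.sets_measure_of_eq space_borel_of_metric)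

lemma weighted_sum_eqI:
  assumes "finite I" "\<And>i. i \<in> I \<Longrightarrow> sets (\<mu> i) = sets (borel_of_metric m)"
    and "sets \<nu> = sets (borel_of_metric m)"
    and "\<And>B. B \<in> sets (borel_of_metric m) \<Longrightarrow>
           emeasure \<nu> B = (\<Sum>i\<in>I. ennreal (w i) * emeasure (\<mu> i) B)"
  shows "\<nu> = weighted_sum m I w \<mu>"
  using assms by (intro measure_eqI) (auto simp: emeasure_weighted_sum)

lemma weighted_sum_cong:
  assumes "finite I" "\<And>i. i \<in> I \<Longrightarrow> sets (\<mu> i) = sets (borel_of_metric m)"
    "\<And>i. i \<in> I \<Longrightarrow> w i = w' i" "\<And>i. i \<in> I \<Longrightarrow> \<mu> i = \<mu>' i"
  shows "weighted_sum m I w \<mu> = weighted_sum m I w' \<mu>'"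
  using assms by (intro weighted_sum_eqI) (auto simp: emeasure_weighted_sum)

lemma weighted_sum_in_borel_prob_measures:
  assumes I: "finite I" and \<mu>: "\<And>i. i \<in> I \<Longrightarrow> \<mu> i \<in> borel_prob_measures m"
    and w: "\<And>i. i \<in> I \<Longrightarrow> 0 \<le> w i" "sum w I = 1"
  shows "weighted_sum m I w \<mu> \<in> borel_prob_measures m"
proof -
  have "emeasure (weighted_sum m I w \<mu>) (mspace m) = (\<Sum>i\<in>I. ennreal (w i) * emeasure (\<mu> i) (mspace m))"
    using borel_prob_measuresD(2)[OF \<mu>] sets.top[of "borel_of_metric m"]
    by (subst emeasure_weighted_sum[OF I]) auto
  also have "\<dots> = (\<Sum>i\<in>I. ennreal (w i))"
  proof (rule sum.cong[OF refl])
    fix i assume "i \<in> I"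
    note mD = borel_prob_measuresD[OF \<mu>[OF this]]
    show "ennreal (w i) * emeasure (\<mu> i) (mspace m) = ennreal (w i)"
      using prob_space.emeasure_space_1[OF mD(1)] mD(3) by simp
  qed
  also have "\<dots> = 1" using w by (subst sum_ennreal) auto
  finally have "prob_space (weighted_sum m I w \<mu>)" by (intro prob_spaceI) simp
  then show ?thesis by (simp add: borel_prob_measures_def)
qed

text \<open>The standard induction over nonnegative measurable functions. Indicators are
  \<open>emeasure_weighted_sum\<close>, and the monotone limit is the only step that needs an
  interchange, of a supremum with a finite sum.\<close>

lemma nn_integral_weighted_sum:
  assumes I: "finite I" and \<mu>: "\<And>i. i \<in> I \<Longrightarrow> sets (\<mu> i) = sets (borel_of_metric m)"
    and h: "h \<in> borel_measurable (borel_of_metric m)"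
  shows "(\<integral>\<^sup>+x. h x \<partial>weighted_sum m I w \<mu>) = (\<Sum>i\<in>I. ennreal (w i) * (\<integral>\<^sup>+x. h x \<partial>\<mu> i))"
  using h
proof (induction rule: borel_measurable_induct)
  note mc = measurable_cong_sets[OF \<mu> refl] measurable_cong_sets[OF sets_weighted_sum[of m I w \<mu>] refl]
  have sp: "space (\<mu> i) = mspace m" if "i \<in> I" for i
    using sets_eq_imp_space_eq[OF \<mu>[OF that]] by simp
  {
    case (cong f g)
    have "(\<integral>\<^sup>+x. f x \<partial>weighted_sum m I w \<mu>) = (\<integral>\<^sup>+x. g x \<partial>weighted_sum m I w \<mu>)"
      "\<And>i. i \<in> I \<Longrightarrow> (\<integral>\<^sup>+x. f x \<partial>\<mu> i) = (\<integral>\<^sup>+x. g x \<partial>\<mu> i)"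
      using cong(3) sp by (auto intro!: nn_integral_cong)
    then show ?case using cong(4) by simp
  next
    case (set A)
    then show ?case using \<mu> by (simp add: emeasure_weighted_sum[OF I \<mu>])
  next
    case (mult u c)
    then show ?case
      by (simp add: nn_integral_cmult mc sum_distrib_left mult.left_commute)
  next
    case (add u v)
    then show ?case
      by (simp add: nn_integral_add mc sum.distrib distrib_left)
  next
    case (seq U)
    have "(\<integral>\<^sup>+x. (SUP n. U n) x \<partial>weighted_sum m I w \<mu>) = (SUP n. \<integral>\<^sup>+x. U n x \<partial>weighted_sum m I w \<mu>)"
      using seq by (simp add: SUP_apply image_comp nn_integral_monotone_convergence_SUP mc)
    also have "\<dots> = (SUP n. \<Sum>i\<in>I. ennreal (w i) * (\<integral>\<^sup>+x. U n x \<partial>\<mu> i))"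
      using seq by simp
    also have "\<dots> = (\<Sum>i\<in>I. SUP n. ennreal (w i) * (\<integral>\<^sup>+x. U n x \<partial>\<mu> i))"
      using \<open>incseq U\<close> by (intro ennreal_SUP_sum)
        (auto simp: incseq_def le_fun_def intro!: mult_left_mono nn_integral_mono)
    also have "\<dots> = (\<Sum>i\<in>I. ennreal (w i) * (\<integral>\<^sup>+x. (SUP n. U n) x \<partial>\<mu> i))"
      using seq by (intro sum.cong) (simp_all add: SUP_apply image_comp nn_integral_monotone_convergence_SUP mc SUP_mult_left_ennreal)
    finally show ?case .
  }
qed

text \<open>Adding the bound \<open>b\<close> makes the integrand nonnegative and reduces the claim
  to the nonnegative case. All measures involved are probability measures and the weights sum to 1,
  so the shift contributes \<open>b\<close> on both sides and cancels.\<close>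

lemma integral_weighted_sum:
  assumes I: "finite I" and \<mu>: "\<And>i. i \<in> I \<Longrightarrow> \<mu> i \<in> borel_prob_measures m"
    and w: "\<And>i. i \<in> I \<Longrightarrow> 0 \<le> w i" "sum w I = 1"
    and h: "h \<in> borel_measurable (borel_of_metric m)"
    and b: "\<And>x. x \<in> mspace m \<Longrightarrow> \<bar>h x\<bar> \<le> b"
  shows "integral\<^sup>L (weighted_sum m I w \<mu>) h = (\<Sum>i\<in>I. w i * integral\<^sup>L (\<mu> i) h)"
proof -
  let ?W = "weighted_sum m I w \<mu>"
  have int: "integrable \<nu> (\<lambda>x. h x + b)" "integrable \<nu> h"
    "ennreal (integral\<^sup>L \<nu> h + b) = (\<integral>\<^sup>+x. ennreal (h x + b) \<partial>\<nu>)" "0 \<le> integral\<^sup>L \<nu> h + b"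
    if \<nu>: "\<nu> \<in> borel_prob_measures m" for \<nu>
  proof -
    note nD = borel_prob_measuresD[OF \<nu>]
    interpret prob_space \<nu> by (rule nD(1))
    have "h \<in> borel_measurable \<nu>" using h nD(2) by (simp cong: measurable_cong_sets)
    then show i: "integrable \<nu> h"
      using b nD(3) by (intro integrable_const_bound[of _ b]) auto
    then show i': "integrable \<nu> (\<lambda>x. h x + b)" by simp
    have e: "(\<integral>x. h x + b \<partial>\<nu>) = integral\<^sup>L \<nu> h + b"
      using i by (simp add: prob_space)
    have nn: "AE x in \<nu>. 0 \<le> h x + b" using b nD(3) by (intro AE_I2) (smt (verit))
    show "ennreal (integral\<^sup>L \<nu> h + b) = (\<integral>\<^sup>+x. ennreal (h x + b) \<partial>\<nu>)"
      using nn_integral_eq_integral[OF i' nn] e by simp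
    show "0 \<le> integral\<^sup>L \<nu> h + b"
      using integral_nonneg_AE[OF nn] e by simp
  qed
  have W: "?W \<in> borel_prob_measures m" by (rule weighted_sum_in_borel_prob_measures[OF I \<mu> w])
  have "ennreal (integral\<^sup>L ?W h + b) = (\<Sum>i\<in>I. ennreal (w i) * ennreal (integral\<^sup>L (\<mu> i) h + b))"
    unfolding int(3)[OF W] using h borel_prob_measuresD(2)[OF \<mu>]
    by (subst nn_integral_weighted_sum[OF I]) (auto intro!: sum.cong simp: int(3)[OF \<mu>])
  also have "\<dots> = ennreal (\<Sum>i\<in>I. w i * (integral\<^sup>L (\<mu> i) h + b))"
    using w int(4)[OF \<mu>] by (subst sum_ennreal[symmetric]) (auto simp: ennreal_mult intro!: sum.cong)
  finally have "integral\<^sup>L ?W h + b = (\<Sum>i\<in>I. w i * (integral\<^sup>L (\<mu> i) h + b))"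
    using int(4)[OF W] w int(4)[OF \<mu>] by (subst (asm) ennreal_inj) (auto intro!: sum_nonneg)
  also have "\<dots> = (\<Sum>i\<in>I. w i * integral\<^sup>L (\<mu> i) h) + b"
    using w(2) by (simp add: distrib_left sum.distrib sum_distrib_right[symmetric])
  finally show ?thesis by simp
qed

text \<open>For a 1-Lipschitz \<open>h\<close>, the function \<open>h (g i x) / c\<close> is again
  1-Lipschitz in \<open>x\<close>, so its integrals against \<open>\<mu> i\<close> and
  \<open>\<nu> i\<close> differ by at most \<open>r\<close>. The weights then average these bounds.
  The division is the reason for \<open>c > 0\<close>.\<close>

lemma MK_dist_weighted_sum:
  assumes D: "diam_le m D" and I: "finite I" and c: "c > 0"
    and w: "\<And>i. i \<in> I \<Longrightarrow> 0 \<le> w i" "sum w I = 1"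
    and g: "\<And>i. i \<in> I \<Longrightarrow> g i \<in> mspace m \<rightarrow> mspace m"
    and gl: "\<And>i x y. i \<in> I \<Longrightarrow> x \<in> mspace m \<Longrightarrow> y \<in> mspace m \<Longrightarrow> mdist m (g i x) (g i y) \<le> c * mdist m x y"
    and P: "\<And>i. i \<in> I \<Longrightarrow> \<mu> i \<in> borel_prob_measures m" "\<And>i. i \<in> I \<Longrightarrow> \<nu> i \<in> borel_prob_measures m"
    and r: "\<And>i. i \<in> I \<Longrightarrow> MK_dist m (\<mu> i) (\<nu> i) \<le> r"
  shows "MK_dist m (weighted_sum m I w (\<lambda>i. push_forward m (g i) (\<mu> i)))
           (weighted_sum m I w (\<lambda>i. push_forward m (g i) (\<nu> i))) \<le> c * r"
proof (rule MK_dist_least)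
  have gm: "g i \<in> measurable (borel_of_metric m) (borel_of_metric m)" if "i \<in> I" for i
    using that g gl by (intro continuous_map_borel_measurable lipschitz_continuous_map)
  have push: "push_forward m (g i) \<kappa> \<in> borel_prob_measures m"
    if "i \<in> I" "\<kappa> \<in> borel_prob_measures m" for i \<kappa>
    using push_forward_in_borel_prob_measures[OF that(2) gm[OF that(1)]] .
  show "weighted_sum m I w (\<lambda>i. push_forward m (g i) (\<mu> i)) \<in> borel_prob_measures m"
    "weighted_sum m I w (\<lambda>i. push_forward m (g i) (\<nu> i)) \<in> borel_prob_measures m"
    using w P push by (auto intro!: weighted_sum_in_borel_prob_measures I)
  fix h assume h: "lipschitz1 m h"
  have "I \<noteq> {}" using w(2) by auto
  then obtain i0 where "i0 \<in> I" by blast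
  then obtain x0 where x0: "x0 \<in> mspace m" using borel_prob_measures_nonempty[OF P(1)] by metis
  have hb: "\<bar>h x\<bar> \<le> \<bar>h x0\<bar> + D" if "x \<in> mspace m" for x
    using h D that x0 unfolding lipschitz1_def diam_le_def by (smt (verit))
  have hm': "h \<in> borel_measurable \<kappa>" if "\<kappa> \<in> borel_prob_measures m" for \<kappa>
    using lipschitz1_measurable[OF h that] .
  have hm: "h \<in> borel_measurable (borel_of_metric m)"
    using hm'[OF P(1)[OF \<open>i0 \<in> I\<close>]] borel_prob_measuresD(2)[OF P(1)[OF \<open>i0 \<in> I\<close>]]
    by (simp cong: measurable_cong_sets)
  have step: "integral\<^sup>L (weighted_sum m I w (\<lambda>i. push_forward m (g i) (\<kappa> i))) h
      = (\<Sum>i\<in>I. w i * (\<integral>x. h (g i x) \<partial>\<kappa> i))"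
    if K: "\<And>i. i \<in> I \<Longrightarrow> \<kappa> i \<in> borel_prob_measures m" for \<kappa>
  proof -
    have "integral\<^sup>L (push_forward m (g i) (\<kappa> i)) h = (\<integral>x. h (g i x) \<partial>\<kappa> i)" if "i \<in> I" for i
      using gm[OF that] hm borel_prob_measuresD(2)[OF K[OF that]]
      by (intro integral_distr) (auto cong: measurable_cong_sets)
    then show ?thesis
      by (subst integral_weighted_sum[OF I _ w hm hb]) (auto intro!: push K)
  qed
  have one: "(\<integral>x. h (g i x) \<partial>\<mu> i) - (\<integral>x. h (g i x) \<partial>\<nu> i) \<le> c * r" if i: "i \<in> I" for i
  proof -
    have "lipschitz1 m (\<lambda>x. h (g i x) / c)"
      unfolding lipschitz1_def
    proof (intro ballI)
      fix x y assume xy: "x \<in> mspace m" "y \<in> mspace m"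
      have "\<bar>h (g i x) - h (g i y)\<bar> \<le> mdist m (g i x) (g i y)"
        using h funcset_mem[OF g[OF i]] xy by (simp add: lipschitz1_def)
      also have "\<dots> \<le> c * mdist m x y" using gl[OF i xy] .
      finally show "\<bar>h (g i x) / c - h (g i y) / c\<bar> \<le> mdist m x y"
        using c by (simp add: diff_divide_distrib[symmetric] divide_le_eq mult.commute)
    qed
    from MK_dist_upper[OF D P(1)[OF i] P(2)[OF i] this] r[OF i]
    have "((\<integral>x. h (g i x) \<partial>\<mu> i) - (\<integral>x. h (g i x) \<partial>\<nu> i)) / c \<le> r"
      by (simp add: diff_divide_distrib)
    then show ?thesis using c by (simp add: divide_le_eq mult.commute)
  qed
  have "integral\<^sup>L (weighted_sum m I w (\<lambda>i. push_forward m (g i) (\<mu> i))) h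
      - integral\<^sup>L (weighted_sum m I w (\<lambda>i. push_forward m (g i) (\<nu> i))) h
    = (\<Sum>i\<in>I. w i * ((\<integral>x. h (g i x) \<partial>\<mu> i) - (\<integral>x. h (g i x) \<partial>\<nu> i)))"
    using P by (simp add: step right_diff_distrib sum_subtractf)
  also have "\<dots> \<le> (\<Sum>i\<in>I. w i * (c * r))"
    using one w by (intro sum_mono mult_left_mono) auto
  also have "\<dots> = c * r" using w(2) by (simp add: sum_distrib_right[symmetric])
  finally show "integral\<^sup>L (weighted_sum m I w (\<lambda>i. push_forward m (g i) (\<mu> i))) h
      - integral\<^sup>L (weighted_sum m I w (\<lambda>i. push_forward m (g i) (\<nu> i))) h \<le> c * r" .
qed

section \<open>Uniqueness of attractors\<close>

text \<open>A point of \<open>A\<close> arises from a point of \<open>A\<close> by k maps; the same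
  maps, applied to any point of \<open>B\<close>, stay in \<open>B\<close> and end within
  \<open>c ^ k * D\<close> of it. So \<open>A\<close> lies in the closure of \<open>B\<close>, and
  the compact set \<open>B\<close> is closed. Only one inclusion is asked of each set, so the lemma
  serves both directions of the uniqueness proof.\<close>

lemma invariant_set_subset:
  assumes D: "diam_le m D" and c: "0 \<le> c" "c < 1"
    and gl: "\<And>a x y. a \<in> I \<Longrightarrow> x \<in> mspace m \<Longrightarrow> y \<in> mspace m \<Longrightarrow> mdist m (g a x) (g a y) \<le> c * mdist m x y"
    and A: "A \<subseteq> mspace m" "A \<subseteq> (\<Union>a\<in>I. g a ` A)"
    and B: "B \<noteq> {}" "compactin (mtopology_of m) B" "(\<Union>a\<in>I. g a ` B) \<subseteq> B"
  shows "A \<subseteq> B"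
proof
  interpret Metric_space "mspace m" "mdist m" by simp
  have Bm: "B \<subseteq> mspace m" using compactin_subset_topspace[OF B(2)] by simp
  have near: "\<exists>y\<in>B. mdist m x y \<le> c ^ k * D" if "x \<in> A" for k x
    using that
  proof (induction k arbitrary: x)
    case 0
    then show ?case using B(1) Bm A(1) D unfolding diam_le_def by fastforce
  next
    case (Suc k)
    then obtain a x' where x': "a \<in> I" "x' \<in> A" "x = g a x'" using A(2) by blast
    then obtain y' where y': "y' \<in> B" "mdist m x' y' \<le> c ^ k * D" using Suc.IH by blast
    have "mdist m x (g a y') \<le> c * mdist m x' y'"
      using gl[OF x'(1)] x' y'(1) A(1) Bm by blast
    also have "\<dots> \<le> c ^ Suc k * D" using mult_left_mono[OF y'(2) c(1)] by (simp add: mult.assoc)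
    finally show ?case using B(3) x'(1) y'(1) by blast
  qed
  fix x assume x: "x \<in> A"
  have "closedin mtopology B"
    using B(2) compactin_imp_closedin[OF Hausdorff_space_mtopology] by (simp add: mtopology_of_def)
  moreover have "x \<in> mtopology closure_of B"
    unfolding metric_closure_of
  proof (intro CollectI conjI allI impI)
    show "x \<in> mspace m" using x A(1) by blast
    fix r :: real assume r: "0 < r"
    have "(\<lambda>k. c ^ k * D) \<longlonglongrightarrow> 0 * D"
      using c by (intro tendsto_mult_right LIMSEQ_power_zero) auto
    then have "\<forall>\<^sub>F k in sequentially. c ^ k * D < r" using r by (auto intro: order_tendstoD(2))
    then obtain k where "c ^ k * D < r" by (auto simp: eventually_sequentially)
    then show "\<exists>y\<in>B. y \<in> mball x r" using near[OF x, of k] Bm x A(1) by fastforce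
  qed
  ultimately show "x \<in> B" by (simp add: closure_of_closedin)
qed

lemma set_attractor_eqI:
  assumes D: "diam_le m D" and c: "0 \<le> c" "c < 1"
    and gl: "\<And>a x y. a \<in> I \<Longrightarrow> x \<in> mspace m \<Longrightarrow> y \<in> mspace m \<Longrightarrow> mdist m (g a x) (g a y) \<le> c * mdist m x y"
    and A: "A \<noteq> {}" "compactin (mtopology_of m) A" "A = (\<Union>a\<in>I. g a ` A)"
  shows "set_attractor m I g = A"
  unfolding set_attractor_def
proof (rule the_equality)
  show "A \<noteq> {} \<and> compactin (mtopology_of m) A \<and> A = (\<Union>a\<in>I. g a ` A)" using A by blast
  fix B assume B: "B \<noteq> {} \<and> compactin (mtopology_of m) B \<and> B = (\<Union>a\<in>I. g a ` B)"
  have sub: "S \<subseteq> mspace m" if "compactin (mtopology_of m) S" for S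
    using compactin_subset_topspace[OF that] by simp
  show "B = A"
  proof (rule subset_antisym)
    show "B \<subseteq> A"
      by (rule invariant_set_subset[OF D c gl]) ((use A B sub[of B] in blast)+)
    show "A \<subseteq> B"
      by (rule invariant_set_subset[OF D c gl]) ((use A B sub[of A] in blast)+)
  qed
qed

lemma measure_attractor_eqI:
  assumes D: "diam_le m D" and I: "finite I" and c: "0 < c" "c < 1"
    and w: "\<And>i. i \<in> I \<Longrightarrow> 0 \<le> w i" "sum w I = 1"
    and g: "\<And>i. i \<in> I \<Longrightarrow> g i \<in> mspace m \<rightarrow> mspace m"
    and gl: "\<And>a x y. a \<in> I \<Longrightarrow> x \<in> mspace m \<Longrightarrow> y \<in> mspace m \<Longrightarrow> mdist m (g a x) (g a y) \<le> c * mdist m x y"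
    and P: "\<mu> \<in> borel_prob_measures m" "\<mu> = weighted_sum m I w (\<lambda>a. push_forward m (g a) \<mu>)"
  shows "measure_attractor m I g w = \<mu>"
  unfolding measure_attractor_def
proof (rule the_equality)
  show "\<mu> \<in> borel_prob_measures m \<and> \<mu> = weighted_sum m I w (\<lambda>a. push_forward m (g a) \<mu>)"
    using P by blast
  fix \<nu> assume N: "\<nu> \<in> borel_prob_measures m \<and> \<nu> = weighted_sum m I w (\<lambda>a. push_forward m (g a) \<nu>)"
  have "MK_dist m (weighted_sum m I w (\<lambda>a. push_forward m (g a) \<nu>))
      (weighted_sum m I w (\<lambda>a. push_forward m (g a) \<mu>)) \<le> c * MK_dist m \<nu> \<mu>"
    by (rule MK_dist_weighted_sum[OF D I c(1) w g gl]) (use N P(1) in auto)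
  then have "MK_dist m \<nu> \<mu> \<le> c * MK_dist m \<nu> \<mu>"
    using N P(2) by metis
  then have "(1 - c) * MK_dist m \<nu> \<mu> \<le> 0" by (simp add: left_diff_distrib)
  then have "MK_dist m \<nu> \<mu> \<le> 0" using c(2) by (simp add: mult_le_0_iff)
  then show "\<nu> = \<mu>" using MK_dist_zero_imp_eq[OF D] N P by blast
qed

section \<open>Contractions driven by a stream of letters\<close>

text \<open>A letter \<open>e\<close> read in state \<open>\<sigma>\<close> applies the contraction \<open>G \<sigma> e\<close> and moves to the state
  \<open>nx \<sigma> e\<close>; \<open>\<pi> \<sigma> s\<close> is the point addressed by the stream \<open>s\<close> from the state \<open>\<sigma>\<close>.\<close>

locale address_map =
  fixes m :: "'a metric" and D c :: real and S :: "'s set" and E :: "'e set"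
    and nx :: "'s \<Rightarrow> 'e \<Rightarrow> 's" and G :: "'s \<Rightarrow> 'e \<Rightarrow> 'a \<Rightarrow> 'a" and \<pi> :: "'s \<Rightarrow> 'e stream \<Rightarrow> 'a"
  assumes diam: "diam_le m D" and c: "0 \<le> c" "c < 1"
    and nx: "\<And>\<sigma> e. \<sigma> \<in> S \<Longrightarrow> e \<in> E \<Longrightarrow> nx \<sigma> e \<in> S"
    and G_into: "\<And>\<sigma> e. \<sigma> \<in> S \<Longrightarrow> e \<in> E \<Longrightarrow> G \<sigma> e \<in> mspace m \<rightarrow> mspace m"
    and G_contr: "\<And>\<sigma> e x y. \<sigma> \<in> S \<Longrightarrow> e \<in> E \<Longrightarrow> x \<in> mspace m \<Longrightarrow> y \<in> mspace m \<Longrightarrow>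
          mdist m (G \<sigma> e x) (G \<sigma> e y) \<le> c * mdist m x y"
    and \<pi>_into: "\<And>\<sigma> s. \<sigma> \<in> S \<Longrightarrow> s \<in> streams E \<Longrightarrow> \<pi> \<sigma> s \<in> mspace m"
    and \<pi>_unfold: "\<And>\<sigma> s. \<sigma> \<in> S \<Longrightarrow> s \<in> streams E \<Longrightarrow>
          \<pi> \<sigma> s = G \<sigma> (shd s) (\<pi> (nx \<sigma> (shd s)) (stl s))"
begin

text \<open>A common first letter applies the same contraction on both sides and leads both streams
  to the same state, so each shared letter gains a factor \<open>c\<close>. The estimate is uniform
  in the state.\<close>

lemma common_prefix_dist:
  assumes "\<sigma> \<in> S" "s \<in> streams E" "t \<in> streams E" "stake k s = stake k t"
  shows "mdist m (\<pi> \<sigma> s) (\<pi> \<sigma> t) \<le> c ^ k * D"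
  using assms
proof (induction k arbitrary: \<sigma> s t)
  case 0
  then show ?case using diam \<pi>_into by (simp add: diam_le_def)
next
  case (Suc k)
  have st: "shd s \<in> E" "stl s \<in> streams E" "stl t \<in> streams E" "shd t = shd s" "stake k (stl s) = stake k (stl t)"
    using Suc.prems by (auto simp: streams_shd streams_stl)
  let ?\<sigma> = "nx \<sigma> (shd s)"
  have \<sigma>: "?\<sigma> \<in> S" using nx Suc.prems(1) st(1) by blast
  have "mdist m (\<pi> \<sigma> s) (\<pi> \<sigma> t) \<le> c * mdist m (\<pi> ?\<sigma> (stl s)) (\<pi> ?\<sigma> (stl t))"
    using G_contr[OF Suc.prems(1) st(1)] \<pi>_into[OF \<sigma>] st Suc.prems by (simp add: \<pi>_unfold[of \<sigma>])
  also have "\<dots> \<le> c ^ Suc k * D"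
    using mult_left_mono[OF Suc.IH[OF \<sigma> st(2,3,5)] c(1)] by (simp add: mult.assoc)
  finally show ?case .
qed

lemma prefix_dist_lt:
  assumes "0 < r"
  shows "\<exists>k. \<forall>\<sigma>\<in>S. \<forall>s\<in>streams E. \<forall>t\<in>streams E. stake k s = stake k t \<longrightarrow>
    mdist m (\<pi> \<sigma> s) (\<pi> \<sigma> t) < r"
proof -
  have "(\<lambda>k. c ^ k * D) \<longlonglongrightarrow> 0 * D"
    using c by (intro tendsto_mult_right LIMSEQ_power_zero) auto
  then have "\<forall>\<^sub>F k in sequentially. c ^ k * D < r" using assms by (auto intro: order_tendstoD(2))
  then obtain k where "c ^ k * D < r" by (auto simp: eventually_sequentially)
  then show ?thesis by (intro exI[of _ k] ballI impI le_less_trans[OF common_prefix_dist])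
qed

text \<open>The address map is continuous on the Tychonoff-compact space of letter sequences.\<close>

lemma compactin_address_image:
  assumes \<sigma>: "\<sigma> \<in> S" and E: "finite E"
  shows "compactin (mtopology_of m) (\<pi> \<sigma> ` streams E)"
proof -
  interpret Metric_space "mspace m" "mdist m" by simp
  let ?T = "product_topology (\<lambda>_::nat. discrete_topology E) UNIV"
  have str: "to_stream x \<in> streams E" if "x \<in> topspace ?T" for x
    using that by (auto simp: streams_iff_snth to_stream_def)
  have "continuous_map ?T mtopology (\<lambda>x. \<pi> \<sigma> (to_stream x))"
    unfolding continuous_map_to_metric
  proof (intro ballI allI impI)
    fix x and r :: real assume x: "x \<in> topspace ?T" and r: "r > 0"
    obtain k where k: "\<forall>\<sigma>\<in>S. \<forall>s\<in>streams E. \<forall>t\<in>streams E. stake k s = stake k t \<longrightarrow>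
      mdist m (\<pi> \<sigma> s) (\<pi> \<sigma> t) < r" using prefix_dist_lt[OF r] by blast
    \<comment> \<open>A cylinder: fixing the first \<open>k\<close> letters constrains finitely many
      coordinates and is therefore open.\<close>
    let ?U = "Pi\<^sub>E UNIV (\<lambda>i. if i < k then {x i} else E)"
    have xE: "x i \<in> E" for i using x by auto
    have sub: "?U \<subseteq> topspace ?T"
      using xE by (auto simp: PiE_def Pi_def split: if_splits)
    have "openin ?T ?U"
    proof (rule openin_PiE_gen[THEN iffD2], intro disjI2 conjI ballI)
      show "finite {i \<in> UNIV. (if i < k then {x i} else E) \<noteq> topspace (discrete_topology E)}"
        by (rule finite_subset[of _ "{..<k}"]) auto
    qed (use xE in auto)
    moreover have "x \<in> ?U" using xE by auto
    moreover have "\<pi> \<sigma> (to_stream y) \<in> mball (\<pi> \<sigma> (to_stream x)) r" if y: "y \<in> ?U" for y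
    proof -
      have yx: "y i = x i" if "i < k" for i using PiE_mem[OF y, of i] that by simp
      have "stake k (to_stream x) = stake k (to_stream y)"
        by (rule nth_equalityI) (auto simp: to_stream_def yx)
      then show ?thesis
        using k[rule_format, OF \<sigma> str[OF x] str[of y]] y sub \<pi>_into[OF \<sigma> str] x by auto
    qed
    ultimately show "\<exists>U. openin ?T U \<and> x \<in> U \<and> (\<forall>y\<in>U. \<pi> \<sigma> (to_stream y) \<in> mball (\<pi> \<sigma> (to_stream x)) r)"
      by blast
  qed
  moreover have "compactin ?T (topspace ?T)"
    using E unfolding compact_space_def[symmetric]
    by (simp add: compact_space_product_topology compact_space_discrete_topology)
  ultimately have "compactin mtopology ((\<lambda>x. \<pi> \<sigma> (to_stream x)) ` topspace ?T)"
    by (rule image_compactin[rotated])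
  moreover have "(\<lambda>x. \<pi> \<sigma> (to_stream x)) ` topspace ?T = \<pi> \<sigma> ` streams E"
  proof (intro equalityI subsetI)
    fix z assume "z \<in> \<pi> \<sigma> ` streams E"
    then obtain s where s: "s \<in> streams E" "z = \<pi> \<sigma> s" by blast
    then have "z = \<pi> \<sigma> (to_stream (snth s))" "snth s \<in> topspace ?T"
      by (auto simp: streams_iff_snth to_stream_def stream_smap_nats[symmetric])
    then show "z \<in> (\<lambda>x. \<pi> \<sigma> (to_stream x)) ` topspace ?T" by blast
  qed (use str in auto)
  ultimately show ?thesis by (simp add: mtopology_of_def)
qed

end

text \<open>The letters fill a whole countable type, so that every stream is an address and the law
  needs no restriction to the support of \<open>q\<close>. Applications decode these letters into
  the ones they are interested in.\<close>

locale random_address = address_map m D c S UNIV nx G \<pi>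
  for m :: "'a metric" and D c :: real and S :: "'s set"
    and nx :: "'s \<Rightarrow> 'e::countable \<Rightarrow> 's" and G :: "'s \<Rightarrow> 'e \<Rightarrow> 'a \<Rightarrow> 'a" and \<pi> :: "'s \<Rightarrow> 'e stream \<Rightarrow> 'a" +
  fixes q :: "'e pmf"
begin

definition law :: "'s \<Rightarrow> 'a measure" where
  "law \<sigma> = distr (stream_space (measure_pmf q)) (borel_of_metric m) (\<pi> \<sigma>)"

text \<open>By \<open>prefix_dist_lt\<close>, the preimage of an open set contains a cylinder around
  each of its streams. It is thus a union of cylinders, a countable one because there are countably
  many finite words.\<close>

lemma measurable_address:
  assumes "\<sigma> \<in> S"
  shows "\<pi> \<sigma> \<in> measurable (stream_space (measure_pmf q)) (borel_of_metric m)"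
proof -
  interpret Metric_space "mspace m" "mdist m" by simp
  have st: "sets (stream_space (measure_pmf q)) = sets (stream_space (count_space UNIV))"
    by (rule sets_stream_space_cong) simp
  have sp: "space (stream_space (count_space (UNIV :: 'e set))) = UNIV"
    by (simp add: space_stream_space)
  have "\<pi> \<sigma> \<in> measurable (stream_space (count_space UNIV)) (borel_of_metric m)"
  proof (rule measurable_borel_of_metricI)
    show "\<pi> \<sigma> \<in> space (stream_space (count_space UNIV)) \<rightarrow> mspace m"
      using \<pi>_into[OF assms] by auto
    fix U assume U: "openin (mtopology_of m) U"
    define cyl :: "'e list \<Rightarrow> 'e stream set" where "cyl w = {s. stake (length w) s = w}" for w
    have "cyl w = stake (length w) -` {w} \<inter> space (stream_space (count_space UNIV))" for w
      by (auto simp: cyl_def sp)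
    then have cyl: "cyl w \<in> sets (stream_space (count_space UNIV))" for w
      using measurable_sets[OF measurable_stake, of "{w}"] by simp
    have "\<pi> \<sigma> -` U = (\<Union>w\<in>{w. cyl w \<subseteq> \<pi> \<sigma> -` U}. cyl w)"
    proof (intro equalityI subsetI)
      fix s assume s: "s \<in> \<pi> \<sigma> -` U"
      then obtain r where r: "r > 0" "mball (\<pi> \<sigma> s) r \<subseteq> U"
        using U by (auto simp: openin_mtopology mtopology_of_def)
      obtain k where k: "\<forall>\<sigma>\<in>S. \<forall>s\<in>streams UNIV. \<forall>t\<in>streams UNIV. stake k s = stake k t \<longrightarrow>
        mdist m (\<pi> \<sigma> s) (\<pi> \<sigma> t) < r" using prefix_dist_lt[OF r(1)] by blast
      have "cyl (stake k s) \<subseteq> \<pi> \<sigma> -` U"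
      proof
        fix t assume "t \<in> cyl (stake k s)"
        then have "stake k s = stake k t" by (simp add: cyl_def)
        then have "mdist m (\<pi> \<sigma> s) (\<pi> \<sigma> t) < r" using k assms by simp
        then show "t \<in> \<pi> \<sigma> -` U" using r(2) \<pi>_into[OF assms] by auto
      qed
      moreover have "s \<in> cyl (stake k s)" by (simp add: cyl_def)
      ultimately show "s \<in> (\<Union>w\<in>{w. cyl w \<subseteq> \<pi> \<sigma> -` U}. cyl w)" by blast
    qed blast
    also have "\<dots> \<in> sets (stream_space (count_space UNIV))"
      using cyl by (intro sets.countable_UN') auto
    finally show "\<pi> \<sigma> -` U \<inter> space (stream_space (count_space UNIV)) \<in> sets (stream_space (count_space UNIV))"
      by (simp add: sp)
  qed
  then show ?thesis by (simp add: measurable_cong_sets[OF st refl])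
qed

lemma law_in_borel_prob_measures:
  assumes "\<sigma> \<in> S"
  shows "law \<sigma> \<in> borel_prob_measures m"
  using prob_space.prob_space_distr[OF prob_space.prob_space_stream_space[OF prob_space_measure_pmf]
      measurable_address[OF assms]]
  by (simp add: law_def borel_prob_measures_def)

text \<open>Conditioning on the first letter: the tail of an i.i.d. stream is distributed like the
  whole stream, so the point it addresses has law \<open>law (nx \<sigma> e)\<close>, and
  \<open>\<pi>_unfold\<close> applies \<open>G \<sigma> e\<close> to that point.\<close>

lemma emeasure_law:
  assumes \<sigma>: "\<sigma> \<in> S" and B: "B \<in> sets (borel_of_metric m)"
  shows "emeasure (law \<sigma>) B = (\<integral>\<^sup>+e. emeasure (push_forward m (G \<sigma> e) (law (nx \<sigma> e))) B \<partial>measure_pmf q)"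
proof -
  let ?Q = "stream_space (measure_pmf q)"
  have sp: "space ?Q = UNIV" by (simp add: space_stream_space)
  have Gm: "G \<sigma> e \<in> measurable (borel_of_metric m) (borel_of_metric m)" for e
    using \<sigma> G_into G_contr by (intro continuous_map_borel_measurable lipschitz_continuous_map) auto
  have "emeasure (law \<sigma>) B = emeasure ?Q (\<pi> \<sigma> -` B \<inter> space ?Q)"
    unfolding law_def by (rule emeasure_distr[OF measurable_address[OF \<sigma>] B])
  also have "\<dots> = (\<integral>\<^sup>+e. emeasure ?Q {s \<in> space ?Q. e ## s \<in> \<pi> \<sigma> -` B \<inter> space ?Q} \<partial>measure_pmf q)"
    using measurable_sets[OF measurable_address[OF \<sigma>] B]
    by (rule prob_space.emeasure_stream_space[OF prob_space_measure_pmf])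
  also have "\<dots> = (\<integral>\<^sup>+e. emeasure (push_forward m (G \<sigma> e) (law (nx \<sigma> e))) B \<partial>measure_pmf q)"
  proof (rule nn_integral_cong)
    fix e
    have n: "nx \<sigma> e \<in> S" using nx \<sigma> by simp
    have "push_forward m (G \<sigma> e) (law (nx \<sigma> e)) = distr ?Q (borel_of_metric m) (G \<sigma> e \<circ> \<pi> (nx \<sigma> e))"
      unfolding law_def by (rule distr_distr[OF Gm measurable_address[OF n]])
    then have "emeasure (push_forward m (G \<sigma> e) (law (nx \<sigma> e))) B = emeasure ?Q ((G \<sigma> e \<circ> \<pi> (nx \<sigma> e)) -` B \<inter> space ?Q)"
      using emeasure_distr[OF measurable_comp[OF measurable_address[OF n] Gm] B] by simp
    also have "(G \<sigma> e \<circ> \<pi> (nx \<sigma> e)) -` B \<inter> space ?Q = {s \<in> space ?Q. e ## s \<in> \<pi> \<sigma> -` B \<inter> space ?Q}"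
      using \<pi>_unfold[OF \<sigma>, of "e ## _"] by (auto simp: sp)
    finally show "emeasure ?Q {s \<in> space ?Q. e ## s \<in> \<pi> \<sigma> -` B \<inter> space ?Q}
      = emeasure (push_forward m (G \<sigma> e) (law (nx \<sigma> e))) B" by simp
  qed
  finally show ?thesis .
qed

text \<open>In the state \<open>\<sigma>\<close> a letter \<open>e\<close> acts only through
  \<open>t e\<close>. Grouping letters by this value turns the integral over \<open>q\<close> into a
  finite sum over the image distribution. The map \<open>t\<close> is a decoding of natural numbers
  in one application and the choice of a branch in the other.\<close>

lemma law_eq_weighted_sum:
  assumes \<sigma>: "\<sigma> \<in> S" and I: "finite I" "set_pmf (map_pmf t q) \<subseteq> I"
    and g: "\<And>e. G \<sigma> e = g (t e)" "\<And>e. nx \<sigma> e = \<tau> (t e)"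
    and w: "\<And>i. i \<in> I \<Longrightarrow> pmf (map_pmf t q) i = w i"
  shows "law \<sigma> = weighted_sum m I w (\<lambda>i. push_forward m (g i) (law (\<tau> i)))"
proof (rule weighted_sum_eqI[OF I(1)])
  show "sets (law \<sigma>) = sets (borel_of_metric m)" by (simp add: law_def)
  fix B assume "B \<in> sets (borel_of_metric m)"
  then have "emeasure (law \<sigma>) B = (\<integral>\<^sup>+e. emeasure (push_forward m (g (t e)) (law (\<tau> (t e)))) B \<partial>measure_pmf q)"
    by (simp add: emeasure_law[OF \<sigma>] g)
  also have "\<dots> = (\<integral>\<^sup>+i. emeasure (push_forward m (g i) (law (\<tau> i))) B \<partial>measure_pmf (map_pmf t q))"
    by simp
  also have "\<dots> = (\<Sum>i\<in>I. emeasure (push_forward m (g i) (law (\<tau> i))) B * pmf (map_pmf t q) i)"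
    using I by (intro nn_integral_measure_pmf_support) (auto simp del: set_map_pmf)
  finally show "emeasure (law \<sigma>) B = (\<Sum>i\<in>I. ennreal (w i) * emeasure (push_forward m (g i) (law (\<tau> i))) B)"
    using w by (simp add: mult.commute)
qed simp

end

section \<open>Existence of attractors from addresses\<close>

text \<open>Prepending letters of \<open>E\<close> to streams over \<open>E\<close> yields exactly
  the streams over \<open>E\<close>, and the address map turns prepending \<open>a\<close> into
  applying \<open>g a\<close>. The single state \<open>()\<close> expresses that the maps do not
  depend on the letters already read.\<close>

lemma invariant_set_exists:
  assumes "address_map m D c {()} E (\<lambda>_ _. ()) (\<lambda>_. g) (\<lambda>_. \<pi>)" and E: "finite E" "E \<noteq> {}"
  shows "\<exists>A. A \<noteq> {} \<and> compactin (mtopology_of m) A \<and> A = (\<Union>a\<in>E. g a ` A)"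
proof (intro exI conjI)
  interpret address_map m D c "{()}" E "\<lambda>_ _. ()" "\<lambda>_. g" "\<lambda>_. \<pi>" by fact
  obtain e where "e \<in> E" using E(2) by blast
  then have "sconst e \<in> streams E" by (simp add: streams_iff_snth)
  then show "\<pi> ` streams E \<noteq> {}" by blast
  show "compactin (mtopology_of m) (\<pi> ` streams E)" by (rule compactin_address_image[OF _ E(1)]) simp
  have un: "\<pi> s = g (shd s) (\<pi> (stl s))" if "s \<in> streams E" for s
    using \<pi>_unfold that by simp
  show "\<pi> ` streams E = (\<Union>a\<in>E. g a ` \<pi> ` streams E)"
  proof (intro equalityI subsetI)
    fix x assume "x \<in> \<pi> ` streams E"
    then obtain s where s: "s \<in> streams E" "x = \<pi> s" by blast
    then have "x = g (shd s) (\<pi> (stl s))" "shd s \<in> E" "stl s \<in> streams E"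
      using un by (auto simp: streams_shd streams_stl)
    then show "x \<in> (\<Union>a\<in>E. g a ` \<pi> ` streams E)" by blast
  next
    fix x assume "x \<in> (\<Union>a\<in>E. g a ` \<pi> ` streams E)"
    then obtain a s where as: "a \<in> E" "s \<in> streams E" "x = g a (\<pi> s)" by blast
    then have "a ## s \<in> streams E" "x = \<pi> (a ## s)" using un[of "a ## s"] by auto
    then show "x \<in> \<pi> ` streams E" by blast
  qed
qed

lemma pmf_of_weights:
  assumes I: "finite I" and w: "\<And>i. i \<in> I \<Longrightarrow> 0 \<le> w i" "sum w I = 1"
  shows "\<exists>q. set_pmf q \<subseteq> I \<and> (\<forall>i\<in>I. pmf q i = w i)"
proof -
  \<comment> \<open>\<open>embed_pmf\<close> wants weights on the whole type, whereas
    \<open>w\<close> is only controlled on \<open>I\<close>.\<close>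
  define v where "v i = (if i \<in> I then w i else 0)" for i
  have v: "v i \<ge> 0" for i using w(1) by (simp add: v_def)
  have "(\<integral>\<^sup>+i. ennreal (v i) \<partial>count_space UNIV) = (\<Sum>i\<in>I. ennreal (v i))"
    by (rule nn_integral_count_space') (use I in \<open>auto simp: v_def\<close>)
  also have "\<dots> = ennreal (\<Sum>i\<in>I. v i)" using v by (intro sum_ennreal)
  also have "\<dots> = 1" using w(2) by (simp add: v_def)
  finally have q: "pmf (embed_pmf v) i = v i" for i
    using v by (intro pmf_embed_pmf) auto
  show ?thesis
    by (rule exI[of _ "embed_pmf v"]) (auto simp: set_pmf_iff q v_def split: if_splits)
qed

text \<open>The letters are encoded as natural numbers because the measurability of the address map
  rests on there being only countably many finite prefixes.\<close>

lemma invariant_measure_exists: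
  assumes "address_map m D c {()} E (\<lambda>_ _. ()) (\<lambda>_. g) (\<lambda>_. \<pi>)" and E: "finite E"
    and w: "\<And>i. i \<in> E \<Longrightarrow> 0 \<le> w i" "sum w E = 1"
  shows "\<exists>\<mu>\<in>borel_prob_measures m. \<mu> = weighted_sum m E w (\<lambda>a. push_forward m (g a) \<mu>)"
proof -
  interpret A: address_map m D c "{()}" E "\<lambda>_ _. ()" "\<lambda>_. g" "\<lambda>_. \<pi>" by fact
  have E0: "E \<noteq> {}" using w(2) by auto
  obtain q0 where q0: "set_pmf q0 \<subseteq> E" "\<And>i. i \<in> E \<Longrightarrow> pmf q0 i = w i"
    using pmf_of_weights[OF E w] by blast
  \<comment> \<open>Every natural number decodes to an element of the nonempty set \<open>E\<close>,
    null letters included; hence each stream of numbers is an address.\<close>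
  define t where "t = from_nat_into E"
  have tE: "t k \<in> E" for k unfolding t_def by (rule from_nat_into[OF E0])
  define q where "q = map_pmf (to_nat_on E) q0"
  have "map_pmf t q = map_pmf (\<lambda>i. i) q0"
    unfolding q_def map_pmf_comp t_def
    using q0(1) E by (intro map_pmf_cong refl from_nat_into_to_nat_on countable_finite) auto
  then have tq: "map_pmf t q = q0" by simp
  interpret random_address m D c "{()}" "\<lambda>_ _. ()" "\<lambda>_ k. g (t k)" "\<lambda>_ s. \<pi> (smap t s)" q
  proof
    have str: "smap t s \<in> streams E" for s by (auto simp: streams_iff_snth tE)
    show "\<pi> (smap t s) \<in> mspace m" for s using A.\<pi>_into str by simp
    show "\<pi> (smap t s) = g (t (shd s)) (\<pi> (smap t (stl s)))" for s
      using A.\<pi>_unfold[of "()", OF _ str[of s]] by (simp only: stream.map_sel singletonI)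
  qed (simp_all add: A.diam A.c A.G_into A.G_contr tE)
  have "law () = weighted_sum m E w (\<lambda>i. push_forward m (g i) (law ()))"
    by (rule law_eq_weighted_sum[where t=t and \<tau>="\<lambda>_. ()" and g=g]) (simp_all add: tq q0 E)
  then show ?thesis by (rule bexI) (rule law_in_borel_prob_measures, simp)
qed

text \<open>Let \<open>ap k\<close> apply the first k letters to \<open>x0\<close>. The approximants
  of index \<open>k + i\<close> and \<open>k + j\<close> share their first \<open>k\<close>
  contractions and are within \<open>c ^ k * D\<close>, hence form a Cauchy sequence. Continuity of
  the first contraction carries the recursion over to the limit.\<close>

lemma address_map_exists:
  assumes complete: "mcomplete_of m" and x0: "x0 \<in> mspace m"
    and diam: "diam_le m D" and c: "0 \<le> c" "c < 1"
    and nx: "\<And>\<sigma> e. \<sigma> \<in> S \<Longrightarrow> e \<in> E \<Longrightarrow> nx \<sigma> e \<in> S"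
    and G_into: "\<And>\<sigma> e. \<sigma> \<in> S \<Longrightarrow> e \<in> E \<Longrightarrow> G \<sigma> e \<in> mspace m \<rightarrow> mspace m"
    and G_contr: "\<And>\<sigma> e x y. \<sigma> \<in> S \<Longrightarrow> e \<in> E \<Longrightarrow> x \<in> mspace m \<Longrightarrow> y \<in> mspace m \<Longrightarrow>
          mdist m (G \<sigma> e x) (G \<sigma> e y) \<le> c * mdist m x y"
  shows "\<exists>\<pi>. address_map m D c S E nx G \<pi>"
proof -
  interpret Metric_space "mspace m" "mdist m" by simp
  define ap where "ap = rec_nat (\<lambda>\<sigma> s. x0) (\<lambda>k h \<sigma> s. G \<sigma> (shd s) (h (nx \<sigma> (shd s)) (stl s)))"
  have ap_0: "ap 0 \<sigma> s = x0" and ap_Suc: "ap (Suc k) \<sigma> s = G \<sigma> (shd s) (ap k (nx \<sigma> (shd s)) (stl s))"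
    for \<sigma> s k by (simp_all add: ap_def)
  have ap_into: "ap k \<sigma> s \<in> mspace m" if "\<sigma> \<in> S" "s \<in> streams E" for k \<sigma> s
    using that
  proof (induction k arbitrary: \<sigma> s)
    case (Suc k)
    then show ?case using G_into[of \<sigma> "shd s"] nx by (auto simp: ap_Suc streams_shd streams_stl Pi_iff)
  qed (simp add: ap_0 x0)
  have ap_dist: "mdist m (ap (k + i) \<sigma> s) (ap (k + j) \<sigma> s) \<le> c ^ k * D"
    if "\<sigma> \<in> S" "s \<in> streams E" for k i j \<sigma> s
    using that
  proof (induction k arbitrary: \<sigma> s)
    case 0
    then show ?case using diam ap_into by (simp add: diam_le_def)
  next
    case (Suc k)
    have s: "shd s \<in> E" "stl s \<in> streams E" using Suc.prems by (auto simp: streams_shd streams_stl)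
    let ?\<sigma> = "nx \<sigma> (shd s)"
    have \<sigma>: "?\<sigma> \<in> S" using nx Suc.prems(1) s(1) by blast
    have "mdist m (ap (Suc k + i) \<sigma> s) (ap (Suc k + j) \<sigma> s)
        \<le> c * mdist m (ap (k + i) ?\<sigma> (stl s)) (ap (k + j) ?\<sigma> (stl s))"
      using G_contr[OF Suc.prems(1) s(1)] ap_into[OF \<sigma> s(2)] by (simp add: ap_Suc)
    also have "\<dots> \<le> c ^ Suc k * D"
      using mult_left_mono[OF Suc.IH[OF \<sigma> s(2)] c(1)] by (simp add: mult.assoc)
    finally show ?case .
  qed
  have "\<exists>x. limitin mtopology (\<lambda>k. ap k \<sigma> s) x sequentially" if \<sigma>s: "\<sigma> \<in> S" "s \<in> streams E" for \<sigma> s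
  proof -
    have "MCauchy (\<lambda>k. ap k \<sigma> s)"
      unfolding MCauchy_def
    proof (intro conjI allI impI)
      show "range (\<lambda>k. ap k \<sigma> s) \<subseteq> mspace m" using ap_into[OF \<sigma>s] by blast
      fix r :: real assume r: "r > 0"
      have "(\<lambda>k. c ^ k * D) \<longlonglongrightarrow> 0 * D"
        using c by (intro tendsto_mult_right LIMSEQ_power_zero) auto
      then have "\<forall>\<^sub>F k in sequentially. c ^ k * D < r" using r by (auto intro: order_tendstoD(2))
      then obtain k where k: "c ^ k * D < r" by (auto simp: eventually_sequentially)
      show "\<exists>N. \<forall>n n'. N \<le> n \<longrightarrow> N \<le> n' \<longrightarrow> mdist m (ap n \<sigma> s) (ap n' \<sigma> s) < r"
      proof (intro exI[of _ k] allI impI)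
        fix n n' assume "k \<le> n" "k \<le> n'"
        then show "mdist m (ap n \<sigma> s) (ap n' \<sigma> s) < r"
          using ap_dist[OF \<sigma>s, of k "n - k" "n' - k"] k by simp
      qed
    qed
    then show ?thesis using complete unfolding mcomplete_of_def mcomplete_def by blast
  qed
  then obtain \<pi> where \<pi>: "\<And>\<sigma> s. \<sigma> \<in> S \<Longrightarrow> s \<in> streams E \<Longrightarrow> limitin mtopology (\<lambda>k. ap k \<sigma> s) (\<pi> \<sigma> s) sequentially"
    by metis
  have "address_map m D c S E nx G \<pi>"
  proof
    fix \<sigma> s assume \<sigma>s: "\<sigma> \<in> S" "s \<in> streams E"
    show "\<pi> \<sigma> s \<in> mspace m" using limitin_mspace[OF \<pi>[OF \<sigma>s]] .
    let ?\<sigma> = "nx \<sigma> (shd s)"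
    have s: "shd s \<in> E" "stl s \<in> streams E" "?\<sigma> \<in> S"
      using \<sigma>s nx by (auto simp: streams_shd streams_stl)
    have "continuous_map mtopology mtopology (G \<sigma> (shd s))"
      using lipschitz_continuous_map[OF G_into[OF \<sigma>s(1) s(1)] G_contr[OF \<sigma>s(1) s(1)]]
      by (simp add: mtopology_of_def)
    then have "limitin mtopology (\<lambda>k. ap (Suc k) \<sigma> s) (G \<sigma> (shd s) (\<pi> ?\<sigma> (stl s))) sequentially"
      using continuous_map_limit[OF _ \<pi>[OF s(3,2)]] by (simp add: ap_Suc o_def)
    moreover have "limitin mtopology (\<lambda>k. ap (Suc k) \<sigma> s) (\<pi> \<sigma> s) sequentially"
      using limitin_sequentially_offset[OF \<pi>[OF \<sigma>s], of 1] by simp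
    ultimately show "\<pi> \<sigma> s = G \<sigma> (shd s) (\<pi> ?\<sigma> (stl s))"
      using limitin_metric_unique by fastforce
  qed (simp_all add: diam c nx G_into G_contr)
  then show ?thesis by blast
qed

section \<open>The maximum metric and code trees\<close>

lemma mdist_power_leI:
  assumes "V \<ge> 1" "\<And>v. v \<in> {1..V} \<Longrightarrow> mdist m (x v) (y v) \<le> r"
  shows "mdist (power_metric V m) x y \<le> r"
  using assms by (subst power_metric_simps(2)) (auto simp: Max_le_iff)

lemma mdist_power_ge:
  assumes "v \<in> {1..V}"
  shows "mdist m (x v) (y v) \<le> mdist (power_metric V m) x y"
  using assms by (subst power_metric_simps(2)) (auto intro!: Max_ge)

lemma power_metric_component:
  assumes "x \<in> mspace (power_metric V m)" "v \<in> {1..V}"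
  shows "x v \<in> mspace m"
proof -
  have "V \<ge> 1" using assms(2) by simp
  then show ?thesis using assms PiE_mem[of x "{1..V}" "\<lambda>_. mspace m" v] by (simp add: power_metric_simps(1))
qed

lemma diam_le_power_metric:
  assumes "V \<ge> 1" "diam_le m D"
  shows "diam_le (power_metric V m) D"
  using assms unfolding diam_le_def
  by (intro ballI mdist_power_leI) (simp_all add: power_metric_component)

lemma continuous_map_power_component:
  assumes "v \<in> {1..V}"
  shows "continuous_map (mtopology_of (power_metric V m)) (mtopology_of m) (\<lambda>x. x v)"
  using assms mdist_power_ge[OF assms]
  by (intro lipschitz_continuous_map[where c=1]) (auto simp: power_metric_simps(1))

lemma continuous_map_power_metric:
  assumes V: "V \<ge> 1" and h: "continuous_map (mtopology_of m) (mtopology_of m') h"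
  shows "continuous_map (mtopology_of (power_metric V m)) (mtopology_of (power_metric V m'))
           (\<lambda>x. \<lambda>v\<in>{1..V}. h (x v))"
proof (rule continuous_map_mtopology_of)
  interpret m': Metric_space "mspace m'" "mdist m'" by simp
  have h_into: "h \<in> mspace m \<rightarrow> mspace m'" using continuous_map_funspace[OF h] by simp
  then show "(\<lambda>x. \<lambda>v\<in>{1..V}. h (x v)) \<in> mspace (power_metric V m) \<rightarrow> mspace (power_metric V m')"
    using V by (auto simp: power_metric_simps(1))
  fix x and e :: real assume x: "x \<in> mspace (power_metric V m)" and e: "e > 0"
  interpret m: Metric_space "mspace m" "mdist m" by simp
  \<comment> \<open>The maximum is later bounded by a weak inequality; \<open>e / 2\<close> leaves
    room for the strict one.\<close>
  have "\<exists>d>0. \<forall>y\<in>mspace m. mdist m (x v) y < d \<longrightarrow> mdist m' (h (x v)) (h y) < e / 2" if "v \<in> {1..V}" for v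
  proof -
    have xv: "x v \<in> mspace m" by (rule power_metric_component[OF x that])
    have "\<forall>x\<in>topspace m.mtopology. \<forall>r>0. \<exists>U. openin m.mtopology U \<and> x \<in> U \<and> (\<forall>y\<in>U. h y \<in> m'.mball (h x) r)"
      using h unfolding mtopology_of_def m'.continuous_map_to_metric .
    then have "\<exists>U. openin m.mtopology U \<and> x v \<in> U \<and> (\<forall>y\<in>U. h y \<in> m'.mball (h (x v)) (e / 2))"
      using xv e by (metis half_gt_zero m.topspace_mtopology)
    then obtain U where U: "openin m.mtopology U" "x v \<in> U" "\<forall>y\<in>U. h y \<in> m'.mball (h (x v)) (e / 2)"
      by (elim exE conjE)
    then obtain d where "d > 0" "m.mball (x v) d \<subseteq> U" unfolding m.openin_mtopology by blast
    then show ?thesis using U(3) xv by (intro exI[of _ d]) auto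
  qed
  then have "\<forall>v\<in>{1..V}. \<exists>d>0. \<forall>y\<in>mspace m. mdist m (x v) y < d \<longrightarrow> mdist m' (h (x v)) (h y) < e / 2"
    by (intro ballI)
  then obtain d where "\<forall>v\<in>{1..V}. 0 < d v \<and> (\<forall>y\<in>mspace m. mdist m (x v) y < d v \<longrightarrow> mdist m' (h (x v)) (h y) < e / 2)"
    by (rule bchoice[THEN exE])
  then have d: "\<And>v. v \<in> {1..V} \<Longrightarrow> d v > 0"
    "\<And>v y. v \<in> {1..V} \<Longrightarrow> y \<in> mspace m \<Longrightarrow> mdist m (x v) y < d v \<Longrightarrow> mdist m' (h (x v)) (h y) < e / 2"
    by simp_all
  show "\<exists>d>0. \<forall>y\<in>mspace (power_metric V m). mdist (power_metric V m) x y < d \<longrightarrow>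
      mdist (power_metric V m') (\<lambda>v\<in>{1..V}. h (x v)) (\<lambda>v\<in>{1..V}. h (y v)) < e"
  proof (intro exI[of _ "Min (d ` {1..V})"] conjI ballI impI)
    show "0 < Min (d ` {1..V})" using d(1) V by (subst Min_gr_iff) auto
    fix y assume y: "y \<in> mspace (power_metric V m)" "mdist (power_metric V m) x y < Min (d ` {1..V})"
    have "mdist (power_metric V m') (\<lambda>v\<in>{1..V}. h (x v)) (\<lambda>v\<in>{1..V}. h (y v)) \<le> e / 2"
    proof (rule mdist_power_leI[OF V])
      fix v assume v: "v \<in> {1..V}"
      have "mdist m (x v) (y v) < Min (d ` {1..V})" using mdist_power_ge[OF v, of m x y] y(2) by simp
      also have "\<dots> \<le> d v" using v by (intro Min_le) auto
      finally show "mdist m' ((\<lambda>v\<in>{1..V}. h (x v)) v) ((\<lambda>v\<in>{1..V}. h (y v)) v) \<le> e / 2"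
        using d(2)[OF v power_metric_component[OF y(1) v]] v by simp
    qed
    then show "mdist (power_metric V m') (\<lambda>v\<in>{1..V}. h (x v)) (\<lambda>v\<in>{1..V}. h (y v)) < e" using e by simp
  qed
qed

section \<open>Distances between code trees\<close>

text \<open>With \<open>code_tree_dist_leI\<close>, this describes the distance of distinct trees as
  the largest \<open>1 / real M ^ length i\<close> over the nodes \<open>i\<close> at which they
  differ, which keeps \<open>LEAST\<close> out of the later proofs.\<close>

lemma code_tree_dist_ge:
  assumes "M \<ge> 1" "i \<in> lists {1..M}" "\<omega> i \<noteq> \<kappa> i"
  shows "1 / real M ^ length i \<le> code_tree_dist M \<omega> \<kappa>"
proof -
  have "(LEAST k. \<exists>i\<in>lists {1..M}. length i = k \<and> \<omega> i \<noteq> \<kappa> i) \<le> length i"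
    using assms by (intro Least_le) blast
  then have "real M ^ (LEAST k. \<exists>i\<in>lists {1..M}. length i = k \<and> \<omega> i \<noteq> \<kappa> i) \<le> real M ^ length i"
    using assms(1) by (intro power_increasing) auto
  moreover have "0 < real M ^ k" for k using assms(1) by simp
  moreover have "\<omega> \<noteq> \<kappa>" using assms(3) by blast
  ultimately show ?thesis unfolding code_tree_dist_def by (simp add: frac_le del: zero_less_power_eq)
qed

lemma code_tree_dist_leI:
  assumes t: "\<omega> \<in> code_trees M N" "\<kappa> \<in> code_trees M N" and r: "0 \<le> r"
    and le: "\<And>i. i \<in> lists {1..M} \<Longrightarrow> \<omega> i \<noteq> \<kappa> i \<Longrightarrow> 1 / real M ^ length i \<le> r"
  shows "code_tree_dist M \<omega> \<kappa> \<le> r"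
proof (cases "\<omega> = \<kappa>")
  case False
  let ?D = "\<lambda>k. \<exists>i\<in>lists {1..M}. length i = k \<and> \<omega> i \<noteq> \<kappa> i"
  \<comment> \<open>Code trees are extensional functions, so distinct ones differ at an actual
    node.\<close>
  have "\<exists>i\<in>lists {1..M}. \<omega> i \<noteq> \<kappa> i"
  proof (rule ccontr)
    assume "\<not> ?thesis"
    then have "\<omega> i = \<kappa> i" if "i \<in> lists {1..M}" for i using that by simp
    then have "\<omega> = \<kappa>" by (rule PiE_ext[OF t[unfolded code_trees_def]])
    then show False using False by simp
  qed
  then have "\<exists>k. ?D k" by blast
  then have "?D (LEAST k. ?D k)" by (rule LeastI_ex)
  then obtain i where i: "i \<in> lists {1..M}" "length i = (LEAST k. ?D k)" "\<omega> i \<noteq> \<kappa> i"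
    by (elim bexE conjE)
  have "code_tree_dist M \<omega> \<kappa> = 1 / real M ^ length i"
    using False by (simp only: code_tree_dist_def i(2) if_False)
  then show ?thesis using le[OF i(1,3)] by simp
qed (use r in \<open>simp add: code_tree_dist_def\<close>)

lemma diam_le_code_tree_metric:
  assumes "M \<ge> 1"
  shows "diam_le (code_tree_metric M N) 1"
  unfolding diam_le_def code_tree_metric_simps[OF assms]
proof (intro ballI)
  fix \<omega> \<kappa> assume "\<omega> \<in> code_trees M N" "\<kappa> \<in> code_trees M N"
  then show "code_tree_dist M \<omega> \<kappa> \<le> 1"
  proof (rule code_tree_dist_leI)
    fix i :: "nat list"
    have "1 \<le> real M ^ length i" using assms by (intro one_le_power) simp
    then show "1 / real M ^ length i \<le> 1" by (subst divide_le_eq_1_pos) linarith+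
  qed simp
qed

lemma tree_join_in_code_trees:
  assumes "n \<in> {1..N}" "\<And>m. m \<in> {1..M} \<Longrightarrow> \<omega> m \<in> code_trees M N"
  shows "tree_join M n \<omega> \<in> code_trees M N"
  unfolding code_trees_def tree_join_def
proof (rule restrict_PiE_iff[THEN iffD2], rule ballI)
  fix i assume "i \<in> lists {1..M}"
  then show "(case i of [] \<Rightarrow> n | m # j \<Rightarrow> \<omega> m j) \<in> {1..N}"
  proof (cases i)
    case (Cons m j)
    then show ?thesis
      using PiE_mem[of "\<omega> m" "lists {1..M}" "\<lambda>_. {1..N}" j] assms(2)[of m] \<open>i \<in> lists {1..M}\<close>
      by (simp add: code_trees_def)
  qed (use assms(1) in simp)
qed

text \<open>The roots carry the same label, so a disagreement at \<open>m # j\<close> is one at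
  \<open>j\<close> between the \<open>m\<close>-th subtrees, one level deeper. This level is the
  factor \<open>1 / real M\<close>.\<close>

lemma code_tree_dist_tree_join:
  assumes M: "M \<ge> 1" and n: "n \<in> {1..N}" and r: "0 \<le> r"
    and t: "\<And>m. m \<in> {1..M} \<Longrightarrow> \<omega> m \<in> code_trees M N" "\<And>m. m \<in> {1..M} \<Longrightarrow> \<kappa> m \<in> code_trees M N"
    and le: "\<And>m. m \<in> {1..M} \<Longrightarrow> code_tree_dist M (\<omega> m) (\<kappa> m) \<le> r"
  shows "code_tree_dist M (tree_join M n \<omega>) (tree_join M n \<kappa>) \<le> 1 / real M * r"
proof (rule code_tree_dist_leI[OF tree_join_in_code_trees[OF n t(1)] tree_join_in_code_trees[OF n t(2)]])
  fix i assume i: "i \<in> lists {1..M}" "tree_join M n \<omega> i \<noteq> tree_join M n \<kappa> i"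
  then obtain m j where ij: "i = m # j" by (cases i) (simp_all add: tree_join_def)
  then have mj: "m \<in> {1..M}" "j \<in> lists {1..M}" using i(1) by simp_all
  have ne: "\<omega> m j \<noteq> \<kappa> m j" using i ij by (simp add: tree_join_def)
  have "1 / real M ^ length j \<le> r" using code_tree_dist_ge[of M j "\<omega> m" "\<kappa> m"] M mj ne le[OF mj(1)] by simp
  then have "1 / real M * (1 / real M ^ length j) \<le> 1 / real M * r" by (intro mult_left_mono) auto
  then show "1 / real M ^ length i \<le> 1 / real M * r" by (simp add: ij)
qed (use r in auto)

section \<open>The IFS on tuples of code trees and its addresses\<close>

lemma ifs_indicesD:
  assumes "a \<in> ifs_indices N V M" "v \<in> {1..V}"
  shows "fst (a v) \<in> {1..N}" "snd (a v) \<in> {1..M} \<rightarrow>\<^sub>E {1..V}"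
    and "\<And>m. m \<in> {1..M} \<Longrightarrow> snd (a v) m \<in> {1..V}"
proof -
  have "a v \<in> {1..N} \<times> ({1..M} \<rightarrow>\<^sub>E {1..V})"
    using PiE_mem[OF assms(1)[unfolded ifs_indices_def] assms(2)] .
  then show "fst (a v) \<in> {1..N}" and s: "snd (a v) \<in> {1..M} \<rightarrow>\<^sub>E {1..V}"
    by (simp_all only: mem_Times_iff)
  show "\<And>m. m \<in> {1..M} \<Longrightarrow> snd (a v) m \<in> {1..V}" using PiE_mem[OF s] .
qed

lemma eta_map_into:
  assumes V: "V \<ge> 1" and M: "M \<ge> 1" and a: "a \<in> ifs_indices N V M"
  shows "eta_map V M a \<in> mspace (power_metric V (code_tree_metric M N)) \<rightarrow> mspace (power_metric V (code_tree_metric M N))"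
proof
  fix \<omega> assume \<omega>: "\<omega> \<in> mspace (power_metric V (code_tree_metric M N))"
  have av: "fst (a v) \<in> {1..N}" "snd (a v) \<in> {1..M} \<rightarrow>\<^sub>E {1..V}" if "v \<in> {1..V}" for v
    using ifs_indicesD[OF a that] by simp_all
  have "tree_join M (fst (a v)) (\<lambda>m\<in>{1..M}. \<omega> (snd (a v) m)) \<in> code_trees M N" if v: "v \<in> {1..V}" for v
  proof (rule tree_join_in_code_trees[OF av(1)[OF v]])
    fix m assume m: "m \<in> {1..M}"
    have "\<omega> (snd (a v) m) \<in> code_trees M N"
      using power_metric_component[OF \<omega> PiE_mem[OF av(2)[OF v] m]] M by (simp add: code_tree_metric_simps(1))
    then show "(\<lambda>m\<in>{1..M}. \<omega> (snd (a v) m)) m \<in> code_trees M N" using m by simp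
  qed
  then show "eta_map V M a \<omega> \<in> mspace (power_metric V (code_tree_metric M N))"
    using V M by (auto simp: eta_map_def power_metric_simps(1) code_tree_metric_simps(1))
qed

lemma eta_map_contraction:
  assumes V: "V \<ge> 1" and M: "M \<ge> 1" and a: "a \<in> ifs_indices N V M"
    and \<omega>: "\<omega> \<in> mspace (power_metric V (code_tree_metric M N))"
    and \<kappa>: "\<kappa> \<in> mspace (power_metric V (code_tree_metric M N))"
  shows "mdist (power_metric V (code_tree_metric M N)) (eta_map V M a \<omega>) (eta_map V M a \<kappa>)
           \<le> 1 / real M * mdist (power_metric V (code_tree_metric M N)) \<omega> \<kappa>"
proof (rule mdist_power_leI[OF V])
  fix v assume v: "v \<in> {1..V}"
  have av: "fst (a v) \<in> {1..N}" "snd (a v) \<in> {1..M} \<rightarrow>\<^sub>E {1..V}"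
    using ifs_indicesD[OF a v] by simp_all
  have t: "\<omega> u \<in> code_trees M N" "\<kappa> u \<in> code_trees M N" if "u \<in> {1..V}" for u
    using power_metric_component[OF \<omega> that] power_metric_component[OF \<kappa> that] M
    by (simp_all add: code_tree_metric_simps(1))
  have sa: "snd (a v) m \<in> {1..V}" if "m \<in> {1..M}" for m using PiE_mem[OF av(2) that] .
  have "code_tree_dist M (tree_join M (fst (a v)) (\<lambda>m\<in>{1..M}. \<omega> (snd (a v) m)))
          (tree_join M (fst (a v)) (\<lambda>m\<in>{1..M}. \<kappa> (snd (a v) m)))
        \<le> 1 / real M * mdist (power_metric V (code_tree_metric M N)) \<omega> \<kappa>"
  proof (rule code_tree_dist_tree_join[OF M av(1)])
    fix m assume m: "m \<in> {1..M}"
    show "code_tree_dist M ((\<lambda>m\<in>{1..M}. \<omega> (snd (a v) m)) m) ((\<lambda>m\<in>{1..M}. \<kappa> (snd (a v) m)) m)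
        \<le> mdist (power_metric V (code_tree_metric M N)) \<omega> \<kappa>"
      using mdist_power_ge[OF sa[OF m], of "code_tree_metric M N" \<omega> \<kappa>] m M
      by (simp add: code_tree_metric_simps(2))
  qed (use t sa in auto)
  then show "mdist (code_tree_metric M N) (eta_map V M a \<omega> v) (eta_map V M a \<kappa> v)
      \<le> 1 / real M * mdist (power_metric V (code_tree_metric M N)) \<omega> \<kappa>"
    using v M by (simp add: eta_map_def code_tree_metric_simps(2))
qed

text \<open>On code trees the addressed point has a closed form instead of being a limit: the k-th
  letter of the stream governs level k of all trees at once, and passing to the \<open>m\<close>-th
  child in tree \<open>v\<close> means continuing in the tree with index
  \<open>snd (shd s v) m\<close>.\<close>

fun address_label :: "ifs_index stream \<Rightarrow> nat \<Rightarrow> nat list \<Rightarrow> nat" where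
  "address_label s v [] = fst (shd s v)"
| "address_label s v (m # j) = address_label (stl s) (snd (shd s v) m) j"

definition address_trees :: "nat \<Rightarrow> nat \<Rightarrow> ifs_index stream \<Rightarrow> nat \<Rightarrow> code_tree" where
  "address_trees V M s = (\<lambda>v\<in>{1..V}. \<lambda>i\<in>lists {1..M}. address_label s v i)"

lemma address_label_range:
  assumes "s \<in> streams (ifs_indices N V M)" "v \<in> {1..V}" "i \<in> lists {1..M}"
  shows "address_label s v i \<in> {1..N}"
  using assms
proof (induction i arbitrary: s v)
  case Nil
  then show ?case using ifs_indicesD(1)[OF streams_shd] by simp
next
  case (Cons m j)
  have "snd (shd s v) m \<in> {1..V}"
    using ifs_indicesD(3)[OF streams_shd[OF Cons.prems(1)] Cons.prems(2)] Cons.prems(3) by simp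
  then show ?case using Cons.IH[OF streams_stl[OF Cons.prems(1)]] Cons.prems(3) by simp
qed

text \<open>The unfolding equation restates the recursion of \<open>address_label\<close>: the head
  letter fixes the roots, the tail fixes the trees hung below them. The bound
  \<open>M \<ge> 2\<close> makes the ratio \<open>1 / real M\<close> smaller than 1.\<close>

lemma address_map_code_trees:
  assumes V: "V \<ge> 1" and M: "M \<ge> 2"
  shows "address_map (power_metric V (code_tree_metric M N)) 1 (1 / real M) {()} (ifs_indices N V M)
           (\<lambda>_ _. ()) (\<lambda>_. eta_map V M) (\<lambda>_. address_trees V M)"
proof
  have M1: "M \<ge> 1" using M by simp
  show "diam_le (power_metric V (code_tree_metric M N)) 1"
    by (rule diam_le_power_metric[OF V diam_le_code_tree_metric[OF M1]])
  show "eta_map V M a \<in> mspace (power_metric V (code_tree_metric M N)) \<rightarrow> mspace (power_metric V (code_tree_metric M N))"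
    if "a \<in> ifs_indices N V M" for a by (rule eta_map_into[OF V M1 that])
  show "mdist (power_metric V (code_tree_metric M N)) (eta_map V M a \<omega>) (eta_map V M a \<kappa>)
           \<le> 1 / real M * mdist (power_metric V (code_tree_metric M N)) \<omega> \<kappa>"
    if "a \<in> ifs_indices N V M" "\<omega> \<in> mspace (power_metric V (code_tree_metric M N))"
      "\<kappa> \<in> mspace (power_metric V (code_tree_metric M N))" for a \<omega> \<kappa>
    by (rule eta_map_contraction[OF V M1 that])
  fix s assume s: "s \<in> streams (ifs_indices N V M)"
  show "address_trees V M s \<in> mspace (power_metric V (code_tree_metric M N))"
    using address_label_range[OF s] V M1
    by (auto simp: power_metric_simps(1) code_tree_metric_simps(1) code_trees_def address_trees_def)
  show "address_trees V M s = eta_map V M (shd s) (address_trees V M (stl s))"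
  proof (intro ext)
    fix v i
    show "address_trees V M s v i = eta_map V M (shd s) (address_trees V M (stl s)) v i"
    proof (cases "v \<in> {1..V} \<and> i \<in> lists {1..M}")
      case True
      then have "snd (shd s v) m \<in> {1..V}" if "m \<in> {1..M}" for m
        using ifs_indicesD(3)[OF streams_shd[OF s] _ that] True by blast
      then show ?thesis
        using True by (cases i) (auto simp: address_trees_def eta_map_def tree_join_def)
    qed (auto simp: address_trees_def eta_map_def tree_join_def)
  qed
qed (use M in auto)

lemma finite_ifs_indices: "finite (ifs_indices N V M)"
  unfolding ifs_indices_def by (intro finite_PiE finite_cartesian_product) auto

lemma ifs_indices_nonempty: "N \<ge> 1 \<Longrightarrow> V \<ge> 1 \<Longrightarrow> ifs_indices N V M \<noteq> {}"
  by (auto simp: ifs_indices_def PiE_eq_empty_iff)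

section \<open>The measure of a code tree\<close>

text \<open>The restriction keeps subtrees extensional, hence inside \<open>code_trees\<close>, and
  makes \<open>subtree_tree_join\<close> an equality of functions.\<close>

definition subtree :: "nat \<Rightarrow> code_tree \<Rightarrow> nat \<Rightarrow> code_tree" where
  "subtree M \<sigma> m = (\<lambda>j\<in>lists {1..M}. \<sigma> (m # j))"

definition words :: "nat \<Rightarrow> nat \<Rightarrow> nat list set" where
  "words M k = {i \<in> lists {1..M}. length i = k}"

lemma root_in_labels: "\<sigma> \<in> code_trees M N \<Longrightarrow> \<sigma> [] \<in> {1..N}"
  using PiE_mem[of \<sigma> "lists {1..M}" "\<lambda>_. {1..N}" "[]"] by (simp add: code_trees_def)

lemma subtree_in_code_trees:
  assumes "\<sigma> \<in> code_trees M N" "m \<in> {1..M}"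
  shows "subtree M \<sigma> m \<in> code_trees M N"
  unfolding code_trees_def subtree_def
proof (rule restrict_PiE_iff[THEN iffD2], rule ballI)
  fix j assume "j \<in> lists {1..M}"
  then have "m # j \<in> lists {1..M}" using assms(2) by simp
  then show "\<sigma> (m # j) \<in> {1..N}" using PiE_mem[OF assms(1)[unfolded code_trees_def]] by blast
qed

lemma subtree_tree_join:
  assumes "m \<in> {1..M}" "\<omega> m \<in> code_trees M N"
  shows "subtree M (tree_join M n \<omega>) m = \<omega> m"
proof (rule ext)
  fix j
  show "subtree M (tree_join M n \<omega>) m j = \<omega> m j"
  proof (cases "j \<in> lists {1..M}")
    case True
    then show ?thesis using assms(1) by (simp add: subtree_def tree_join_def)
  next
    case False
    then show ?thesis using PiE_arb[OF assms(2)[unfolded code_trees_def] False]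
      by (simp only: subtree_def restrict_apply if_False)
  qed
qed

lemma finite_words [simp]: "finite (words M k)"
proof -
  have "words M k = {i. set i \<subseteq> {1..M} \<and> length i = k}" by (auto simp: words_def in_lists_conv_set)
  then show ?thesis by (simp only: finite_lists_length_eq finite_atLeastAtMost)
qed

lemma words_0 [simp]: "words M 0 = {[]}"
  by (auto simp: words_def)

lemma sum_words_Suc: "(\<Sum>i\<in>words M (Suc k). h i) = (\<Sum>m\<in>{1..M}. \<Sum>j\<in>words M k. h (m # j))"
proof -
  have "words M (Suc k) = (\<lambda>(m, j). m # j) ` ({1..M} \<times> words M k)"
    by (auto simp: words_def length_Suc_conv)
  then have "(\<Sum>i\<in>words M (Suc k). h i) = (\<Sum>(m, j)\<in>{1..M} \<times> words M k. h (m # j))"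
    by (simp add: sum.reindex inj_on_def case_prod_beta)
  then show ?thesis by (simp add: sum.cartesian_product)
qed

lemma subtree_take:
  assumes "i \<in> lists {1..M}"
  shows "subtree M \<sigma> m (take j i) = \<sigma> (m # take j i)"
proof -
  have "take j i \<in> lists {1..M}" using assms set_take_subset[of j i] by (auto simp: in_lists_conv_set)
  then show ?thesis by (simp add: subtree_def)
qed

text \<open>Words are split at the first letter, that is at the root, because the rest of the word
  is then a path in a subtree. The same split is made for \<open>path_map\<close>, where the root
  contributes the outermost map.\<close>

lemma path_weight_Cons:
  assumes "i \<in> lists {1..M}"
  shows "path_weight p \<sigma> (m # i) = p (\<sigma> []) m * path_weight p (subtree M \<sigma> m) i"
  by (simp add: path_weight_def prod.lessThan_Suc_shift subtree_take[OF assms] del: prod.lessThan_Suc)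

lemma path_map_Cons:
  assumes "i \<in> lists {1..M}"
  shows "path_map f \<sigma> (m # i) = f (\<sigma> []) m \<circ> path_map f (subtree M \<sigma> m) i"
proof -
  have "[0..<length (m # i)] = 0 # map Suc [0..<length i]"
    by (simp add: upt_conv_Cons map_Suc_upt del: upt_Suc)
  then show ?thesis
    by (simp add: path_map_def foldr_map subtree_take[OF assms] comp_def)
qed

text \<open>Here \<open>l\<close> is positive, as \<open>MK_dist_weighted_sum\<close> divides by it.
  The theorem enters the locale with an enlarged constant.\<close>

locale superifs =
  fixes X :: "'a metric" and M N :: nat and l D :: real
    and f :: "nat \<Rightarrow> nat \<Rightarrow> 'a \<Rightarrow> 'a" and p :: "nat \<Rightarrow> nat \<Rightarrow> real"
  assumes X: "mspace X \<noteq> {}" "compact_space (mtopology_of X)" and diam: "diam_le X D"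
    and M: "M \<ge> 1" and l: "0 < l" "l < 1"
    and f_into: "\<And>n m. n \<in> {1..N} \<Longrightarrow> m \<in> {1..M} \<Longrightarrow> f n m \<in> mspace X \<rightarrow> mspace X"
    and f_lipschitz: "\<And>n m x y. n \<in> {1..N} \<Longrightarrow> m \<in> {1..M} \<Longrightarrow> x \<in> mspace X \<Longrightarrow> y \<in> mspace X
          \<Longrightarrow> mdist X (f n m x) (f n m y) \<le> l * mdist X x y"
    and p_nonneg: "\<And>n m. n \<in> {1..N} \<Longrightarrow> m \<in> {1..M} \<Longrightarrow> p n m \<ge> 0"
    and p_sum: "\<And>n. n \<in> {1..N} \<Longrightarrow> (\<Sum>m=1..M. p n m) = 1"
begin

lemma f_measurable:
  "n \<in> {1..N} \<Longrightarrow> m \<in> {1..M} \<Longrightarrow> f n m \<in> measurable (borel_of_metric X) (borel_of_metric X)"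
  using f_into f_lipschitz by (intro continuous_map_borel_measurable lipschitz_continuous_map)

text \<open>One level of a code tree with root label \<open>n\<close>. Both the components of
  \<open>f_map\<close> and the recursion of the approximations have this shape.\<close>

definition mix :: "nat \<Rightarrow> (nat \<Rightarrow> 'a measure) \<Rightarrow> 'a measure" where
  "mix n \<mu> = weighted_sum X {1..M} (p n) (\<lambda>m. push_forward X (f n m) (\<mu> m))"

lemma mix_in_borel_prob_measures:
  assumes n: "n \<in> {1..N}" and \<mu>: "\<And>m. m \<in> {1..M} \<Longrightarrow> \<mu> m \<in> borel_prob_measures X"
  shows "mix n \<mu> \<in> borel_prob_measures X"
  unfolding mix_def
  by (rule weighted_sum_in_borel_prob_measures)
    (simp_all only: finite_atLeastAtMost p_nonneg[OF n] p_sum[OF n] 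
      push_forward_in_borel_prob_measures[OF \<mu> f_measurable[OF n]])

lemma mix_cong:
  assumes "\<And>m. m \<in> {1..M} \<Longrightarrow> \<mu> m = \<nu> m"
  shows "mix n \<mu> = mix n \<nu>"
  unfolding mix_def by (rule weighted_sum_cong) (simp_all add: assms)

lemma MK_dist_mix:
  assumes n: "n \<in> {1..N}"
    and \<mu>: "\<And>m. m \<in> {1..M} \<Longrightarrow> \<mu> m \<in> borel_prob_measures X" "\<And>m. m \<in> {1..M} \<Longrightarrow> \<nu> m \<in> borel_prob_measures X"
    and r: "\<And>m. m \<in> {1..M} \<Longrightarrow> MK_dist X (\<mu> m) (\<nu> m) \<le> r"
  shows "MK_dist X (mix n \<mu>) (mix n \<nu>) \<le> l * r"
  unfolding mix_def
  by (rule MK_dist_weighted_sum[OF diam finite_atLeastAtMost l(1) p_nonneg[OF n] p_sum[OF n]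
        f_into[OF n] f_lipschitz[OF n] \<mu> r])

lemma path_weight_nonneg:
  assumes "\<sigma> \<in> code_trees M N" "i \<in> lists {1..M}"
  shows "path_weight p \<sigma> i \<ge> 0"
  using assms
proof (induction i arbitrary: \<sigma>)
  case (Cons m i)
  then have "m \<in> {1..M}" "i \<in> lists {1..M}" by simp_all
  then show ?case
    using Cons.IH[OF subtree_in_code_trees[OF Cons.prems(1)]] p_nonneg[OF root_in_labels[OF Cons.prems(1)]]
    by (simp add: path_weight_Cons)
qed (simp add: path_weight_def)

lemma path_map_measurable:
  assumes "\<sigma> \<in> code_trees M N" "i \<in> lists {1..M}"
  shows "path_map f \<sigma> i \<in> measurable (borel_of_metric X) (borel_of_metric X)"
  using assms
proof (induction i arbitrary: \<sigma>)
  case (Cons m i)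
  then have mi: "m \<in> {1..M}" "i \<in> lists {1..M}" by simp_all
  show ?case
    unfolding path_map_Cons[OF mi(2)]
    by (rule measurable_comp[OF Cons.IH[OF subtree_in_code_trees[OF Cons.prems(1) mi(1)] mi(2)]
          f_measurable[OF root_in_labels[OF Cons.prems(1)] mi(1)]])
qed (simp add: path_map_def)

section \<open>The approximations and their recursion at the root\<close>

lemma emeasure_tree_approx:
  assumes "\<zeta> \<in> borel_prob_measures X" "\<sigma> \<in> code_trees M N" "B \<in> sets (borel_of_metric X)"
  shows "emeasure (tree_approx X M f p \<sigma> \<zeta> k) B
       = (\<Sum>i\<in>words M k. ennreal (path_weight p \<sigma> i) * emeasure \<zeta> (path_map f \<sigma> i -` B \<inter> mspace X))"
proof -
  have "emeasure (push_forward X (path_map f \<sigma> i) \<zeta>) B = emeasure \<zeta> (path_map f \<sigma> i -` B \<inter> mspace X)"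
    if "i \<in> words M k" for i
  proof -
    have "path_map f \<sigma> i \<in> measurable \<zeta> (borel_of_metric X)"
      using path_map_measurable[OF assms(2)] that borel_prob_measuresD(2)[OF assms(1)]
      by (simp add: words_def cong: measurable_cong_sets)
    then show ?thesis using assms(3) borel_prob_measuresD(3)[OF assms(1)] by (simp add: emeasure_distr)
  qed
  then show ?thesis
    unfolding tree_approx_def words_def[symmetric] using assms(3)
    by (simp add: emeasure_weighted_sum)
qed

lemma tree_approx_0:
  assumes "\<zeta> \<in> borel_prob_measures X" "\<sigma> \<in> code_trees M N"
  shows "tree_approx X M f p \<sigma> \<zeta> 0 = \<zeta>"
proof (rule measure_eqI)
  show "sets (tree_approx X M f p \<sigma> \<zeta> 0) = sets \<zeta>"
    using borel_prob_measuresD(2)[OF assms(1)] by (simp add: tree_approx_def)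
  fix B assume "B \<in> sets (tree_approx X M f p \<sigma> \<zeta> 0)"
  then have B: "B \<in> sets (borel_of_metric X)" by (simp add: tree_approx_def)
  have "B \<inter> mspace X = B" using sets.sets_into_space[OF B] by auto
  then show "emeasure (tree_approx X M f p \<sigma> \<zeta> 0) B = emeasure \<zeta> B"
    by (simp add: emeasure_tree_approx[OF assms B] path_weight_def path_map_def)
qed

text \<open>Grouping the words of length k + 1 by first letter splits the root factor off both
  weight and map; what remains is the k-th approximation of a subtree. The starting measure stays at
  the leaves and is the same for all subtrees.\<close>

lemma tree_approx_Suc:
  assumes \<zeta>: "\<zeta> \<in> borel_prob_measures X" and \<sigma>: "\<sigma> \<in> code_trees M N"
  shows "tree_approx X M f p \<sigma> \<zeta> (Suc k) = mix (\<sigma> []) (\<lambda>m. tree_approx X M f p (subtree M \<sigma> m) \<zeta> k)"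
  unfolding mix_def
proof (rule weighted_sum_eqI)
  show "sets (tree_approx X M f p \<sigma> \<zeta> (Suc k)) = sets (borel_of_metric X)" by (simp add: tree_approx_def)
  fix B assume B: "B \<in> sets (borel_of_metric X)"
  note n = root_in_labels[OF \<sigma>]
  have "(\<Sum>j\<in>words M k. ennreal (path_weight p \<sigma> (m # j)) * emeasure \<zeta> (path_map f \<sigma> (m # j) -` B \<inter> mspace X))
      = ennreal (p (\<sigma> []) m) * emeasure (push_forward X (f (\<sigma> []) m) (tree_approx X M f p (subtree M \<sigma> m) \<zeta> k)) B"
    if m: "m \<in> {1..M}" for m
  proof -
    note \<sigma>m = subtree_in_code_trees[OF \<sigma> m]
    let ?B = "f (\<sigma> []) m -` B \<inter> mspace X"
    have B': "?B \<in> sets (borel_of_metric X)"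
      using measurable_sets[OF f_measurable[OF n m] B] by simp
    have "f (\<sigma> []) m \<in> measurable (tree_approx X M f p (subtree M \<sigma> m) \<zeta> k) (borel_of_metric X)"
      using f_measurable[OF n m] by (simp add: tree_approx_def cong: measurable_cong_sets)
    then have "emeasure (push_forward X (f (\<sigma> []) m) (tree_approx X M f p (subtree M \<sigma> m) \<zeta> k)) B
      = emeasure (tree_approx X M f p (subtree M \<sigma> m) \<zeta> k) ?B"
      using B by (simp add: emeasure_distr tree_approx_def)
    also have "\<dots> = (\<Sum>j\<in>words M k. ennreal (path_weight p (subtree M \<sigma> m) j)
        * emeasure \<zeta> (path_map f (subtree M \<sigma> m) j -` ?B \<inter> mspace X))"
      by (rule emeasure_tree_approx[OF \<zeta> \<sigma>m B'])
    finally show ?thesis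
    proof (simp only: sum_distrib_left, intro sum.cong refl)
      fix j assume "j \<in> words M k"
      then have j: "j \<in> lists {1..M}" by (simp add: words_def)
      have "path_map f (subtree M \<sigma> m) j x \<in> mspace X" if "x \<in> mspace X" for x
        using measurable_space[OF path_map_measurable[OF \<sigma>m j]] that by simp
      then have "path_map f \<sigma> (m # j) -` B \<inter> mspace X = path_map f (subtree M \<sigma> m) j -` ?B \<inter> mspace X"
        by (auto simp: path_map_Cons[OF j])
      then show "ennreal (path_weight p \<sigma> (m # j)) * emeasure \<zeta> (path_map f \<sigma> (m # j) -` B \<inter> mspace X)
        = ennreal (p (\<sigma> []) m) * (ennreal (path_weight p (subtree M \<sigma> m) j)
            * emeasure \<zeta> (path_map f (subtree M \<sigma> m) j -` ?B \<inter> mspace X))"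
        using p_nonneg[OF n m] path_weight_nonneg[OF \<sigma>m j]
        by (simp add: path_weight_Cons[OF j] ennreal_mult mult.assoc)
    qed
  qed
  then show "emeasure (tree_approx X M f p \<sigma> \<zeta> (Suc k)) B = (\<Sum>m\<in>{1..M}. ennreal (p (\<sigma> []) m) *
      emeasure (push_forward X (f (\<sigma> []) m) (tree_approx X M f p (subtree M \<sigma> m) \<zeta> k)) B)"
    unfolding emeasure_tree_approx[OF \<zeta> \<sigma> B] sum_words_Suc by (intro sum.cong refl)
qed simp_all

lemma tree_approx_in_borel_prob_measures:
  assumes "\<zeta> \<in> borel_prob_measures X" "\<sigma> \<in> code_trees M N"
  shows "tree_approx X M f p \<sigma> \<zeta> k \<in> borel_prob_measures X"
  using assms(2)
proof (induction k arbitrary: \<sigma>)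
  case (Suc k)
  show ?case
    unfolding tree_approx_Suc[OF assms(1) Suc.prems]
    by (rule mix_in_borel_prob_measures[OF root_in_labels[OF Suc.prems]
          Suc.IH[OF subtree_in_code_trees[OF Suc.prems]]])
qed (simp add: tree_approx_0 assms)

text \<open>A letter is a list \<open>e\<close> whose \<open>n\<close>-th entry is distributed according to \<open>p n\<close>: it prepares
  the branch to follow for every possible label of the current node, so that one i.i.d. sequence of
  letters drives all code trees simultaneously. The clamping to \<open>1\<close> only concerns null letters.\<close>

lemma self_similar_measures_exist:
  "\<exists>L. \<forall>\<sigma>\<in>code_trees M N. L \<sigma> \<in> borel_prob_measures X \<and> L \<sigma> = mix (\<sigma> []) (\<lambda>m. L (subtree M \<sigma> m))"
proof -
  have "\<forall>n\<in>{1..N}. \<exists>q. set_pmf q \<subseteq> {1..M} \<and> (\<forall>m\<in>{1..M}. pmf q m = p n m)"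
    using pmf_of_weights[OF finite_atLeastAtMost p_nonneg p_sum] by blast
  then obtain qn where "\<forall>n\<in>{1..N}. set_pmf (qn n) \<subseteq> {1..M} \<and> (\<forall>m\<in>{1..M}. pmf (qn n) m = p n m)"
    by (rule bchoice[THEN exE])
  then have qn: "\<And>n. n \<in> {1..N} \<Longrightarrow> set_pmf (qn n) \<subseteq> {1..M}"
    "\<And>n m. n \<in> {1..N} \<Longrightarrow> m \<in> {1..M} \<Longrightarrow> pmf (qn n) m = p n m" by simp_all
  \<comment> \<open>\<open>Pi_pmf\<close> lives on functions, which form an uncountable type;
    listing the values at 0 to N makes the letters countable and lets a label \<open>n\<close> be a
    list position.\<close>
  define q where "q = map_pmf (\<lambda>g. map g [0..<Suc N]) (Pi_pmf {..N} 0 qn)"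
  define branch where "branch n e = (if e ! n \<in> {1..M} then e ! n else 1)" for n :: nat and e :: "nat list"
  have branch: "branch n e \<in> {1..M}" for n e using M by (simp add: branch_def)
  have br: "map_pmf (branch n) q = qn n" if n: "n \<in> {1..N}" for n
  proof -
    have "map_pmf (branch n) q = map_pmf (\<lambda>g. if g n \<in> {1..M} then g n else 1) (Pi_pmf {..N} 0 qn)"
      unfolding q_def map_pmf_comp branch_def using n by (intro map_pmf_cong refl) (simp del: upt_Suc)
    also have "\<dots> = map_pmf (\<lambda>m. if m \<in> {1..M} then m else 1) (map_pmf (\<lambda>g. g n) (Pi_pmf {..N} 0 qn))"
      by (simp add: map_pmf_comp)
    also have "map_pmf (\<lambda>g. g n) (Pi_pmf {..N} 0 qn) = qn n"
      using n by (subst Pi_pmf_component) auto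
    also have "map_pmf (\<lambda>m. if m \<in> {1..M} then m else 1) (qn n) = map_pmf (\<lambda>m. m) (qn n)"
    proof (intro map_pmf_cong refl)
      fix m assume "m \<in> set_pmf (qn n)"
      then have "m \<in> {1..M}" using qn(1)[OF n] by blast
      then show "(if m \<in> {1..M} then m else 1) = m" by simp
    qed
    finally show ?thesis by simp
  qed
  interpret Metric_space "mspace X" "mdist X" by simp
  obtain x0 where x0: "x0 \<in> mspace X" using X(1) by blast
  have "mcomplete_of X"
    using compact_space_imp_mcomplete X(2) by (simp add: mcomplete_of_def mtopology_of_def)
  then have "\<exists>\<pi>. address_map X D l (code_trees M N) (UNIV :: nat list set)
      (\<lambda>\<sigma> e. subtree M \<sigma> (branch (\<sigma> []) e)) (\<lambda>\<sigma> e. f (\<sigma> []) (branch (\<sigma> []) e)) \<pi>"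
    by (rule address_map_exists[OF _ x0 diam less_imp_le[OF l(1)] l(2)])
      (simp_all only: subtree_in_code_trees branch f_into f_lipschitz root_in_labels)
  then obtain \<pi> where "address_map X D l (code_trees M N) (UNIV :: nat list set)
      (\<lambda>\<sigma> e. subtree M \<sigma> (branch (\<sigma> []) e)) (\<lambda>\<sigma> e. f (\<sigma> []) (branch (\<sigma> []) e)) \<pi>" ..
  then interpret random_address X D l "code_trees M N" "\<lambda>\<sigma> e. subtree M \<sigma> (branch (\<sigma> []) e)"
    "\<lambda>\<sigma> e. f (\<sigma> []) (branch (\<sigma> []) e)" \<pi> q
    by (rule random_address.intro)
  \<comment> \<open>In the state \<open>\<sigma>\<close> a letter acts only through the branch
    chosen for the root label, and by \<open>br\<close> this branch has the weights
    \<open>p (\<sigma> [])\<close>.\<close>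
  have "law \<sigma> = mix (\<sigma> []) (\<lambda>m. law (subtree M \<sigma> m))" if \<sigma>: "\<sigma> \<in> code_trees M N" for \<sigma>
    unfolding mix_def using root_in_labels[OF \<sigma>]
    by (intro law_eq_weighted_sum[OF \<sigma> finite_atLeastAtMost, where t="branch (\<sigma> [])"]
        refl) (simp_all only: br qn)
  then show ?thesis using law_in_borel_prob_measures by (intro exI[of _ law] ballI conjI)
qed

section \<open>Convergence of the approximations\<close>

text \<open>Approximation and limit obey the same recursion with the same root label, so each level
  gains a factor \<open>l\<close>; at depth 0 the diameter bound is all that is known.\<close>

lemma MK_dist_tree_approx:
  assumes L: "\<And>\<sigma>. \<sigma> \<in> code_trees M N \<Longrightarrow> L \<sigma> \<in> borel_prob_measures X"
      "\<And>\<sigma>. \<sigma> \<in> code_trees M N \<Longrightarrow> L \<sigma> = mix (\<sigma> []) (\<lambda>m. L (subtree M \<sigma> m))"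
    and \<zeta>: "\<zeta> \<in> borel_prob_measures X" and \<sigma>: "\<sigma> \<in> code_trees M N"
  shows "MK_dist X (tree_approx X M f p \<sigma> \<zeta> k) (L \<sigma>) \<le> l ^ k * (2 * D)"
  using \<sigma>
proof (induction k arbitrary: \<sigma>)
  case 0
  then show ?case using MK_dist_le_diam[OF diam \<zeta> L(1)] by (simp add: tree_approx_0[OF \<zeta>])
next
  case (Suc k)
  note s = subtree_in_code_trees[OF Suc.prems]
  have "MK_dist X (tree_approx X M f p \<sigma> \<zeta> (Suc k)) (L \<sigma>)
    = MK_dist X (mix (\<sigma> []) (\<lambda>m. tree_approx X M f p (subtree M \<sigma> m) \<zeta> k)) (mix (\<sigma> []) (\<lambda>m. L (subtree M \<sigma> m)))"
    by (simp only: tree_approx_Suc[OF \<zeta> Suc.prems] L(2)[OF Suc.prems, symmetric])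
  also have "\<dots> \<le> l * (l ^ k * (2 * D))"
    by (rule MK_dist_mix[OF root_in_labels[OF Suc.prems] tree_approx_in_borel_prob_measures[OF \<zeta> s] L(1)[OF s] Suc.IH[OF s]])
  finally show ?case by (simp add: mult.assoc)
qed

lemma power_l_small:
  assumes "0 < r"
  obtains K where "\<And>k. K \<le> k \<Longrightarrow> l ^ k * (2 * D) < r"
proof -
  have "(\<lambda>k. l ^ k * (2 * D)) \<longlonglongrightarrow> 0 * (2 * D)"
    using l by (intro tendsto_mult_right LIMSEQ_power_zero) auto
  then have "\<forall>\<^sub>F k in sequentially. l ^ k * (2 * D) < r" using assms by (auto intro: order_tendstoD(2))
  then show ?thesis using that by (auto simp: eventually_sequentially)
qed

text \<open>A solution of the recursion attracts the approximations from every starting measure at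
  one geometric rate, so it is the limit described in \<open>tree_measure\<close>.\<close>

lemma tree_measure_eqI:
  assumes L: "\<And>\<sigma>. \<sigma> \<in> code_trees M N \<Longrightarrow> L \<sigma> \<in> borel_prob_measures X"
      "\<And>\<sigma>. \<sigma> \<in> code_trees M N \<Longrightarrow> L \<sigma> = mix (\<sigma> []) (\<lambda>m. L (subtree M \<sigma> m))"
    and \<sigma>: "\<sigma> \<in> code_trees M N"
  shows "tree_measure X M f p \<sigma> = L \<sigma>"
proof -
  interpret MK: Metric_space "borel_prob_measures X" "MK_dist X" by (rule MK_Metric_space[OF X(2)])
  have top: "mtopology_of (MK_metric X) = MK.mtopology"
    by (simp add: mtopology_of_def MK_metric_simps[OF X(2)])
  have lim: "limitin (mtopology_of (MK_metric X)) (tree_approx X M f p \<sigma> \<zeta>) (L \<sigma>) sequentially"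
    if \<zeta>: "\<zeta> \<in> borel_prob_measures X" for \<zeta>
    unfolding top MK.limitin_metric
  proof (intro conjI allI impI)
    show "L \<sigma> \<in> borel_prob_measures X" by (rule L(1)[OF \<sigma>])
    fix r :: real assume "r > 0"
    then obtain K where K: "\<And>k. K \<le> k \<Longrightarrow> l ^ k * (2 * D) < r" using power_l_small by blast
    show "\<forall>\<^sub>F k in sequentially. tree_approx X M f p \<sigma> \<zeta> k \<in> borel_prob_measures X \<and>
        MK_dist X (tree_approx X M f p \<sigma> \<zeta> k) (L \<sigma>) < r"
      using tree_approx_in_borel_prob_measures[OF \<zeta> \<sigma>] le_less_trans[OF MK_dist_tree_approx[OF L \<zeta> \<sigma>] K]
      unfolding eventually_sequentially by (intro exI[of _ K] allI impI conjI)
  qed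
  show ?thesis
    unfolding tree_measure_def
  proof (rule the_equality)
    \<comment> \<open>A limit common to all starting measures is pinned down as soon as one starting
      measure exists; \<open>L \<sigma>\<close> itself is one.\<close>
    fix \<mu> assume "\<forall>\<zeta>\<in>borel_prob_measures X.
        limitin (mtopology_of (MK_metric X)) (tree_approx X M f p \<sigma> \<zeta>) \<mu> sequentially"
    then have "limitin MK.mtopology (tree_approx X M f p \<sigma> (L \<sigma>)) \<mu> sequentially"
      using L(1)[OF \<sigma>] top by simp
    moreover have "limitin MK.mtopology (tree_approx X M f p \<sigma> (L \<sigma>)) (L \<sigma>) sequentially"
      using lim[OF L(1)[OF \<sigma>]] top by simp
    ultimately show "\<mu> = L \<sigma>"
      using MK.limitin_metric_unique sequentially_bot by blast
  qed (use lim in blast)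
qed

text \<open>The auxiliary family \<open>L\<close> disappears here. From now on the recursion is the
  working description of the tree measures.\<close>

lemma tree_measure_in_borel_prob_measures:
    "\<sigma> \<in> code_trees M N \<Longrightarrow> tree_measure X M f p \<sigma> \<in> borel_prob_measures X"
  and tree_measure_unfold: "\<sigma> \<in> code_trees M N \<Longrightarrow>
    tree_measure X M f p \<sigma> = mix (\<sigma> []) (\<lambda>m. tree_measure X M f p (subtree M \<sigma> m))"
proof -
  obtain L where L: "\<And>\<sigma>. \<sigma> \<in> code_trees M N \<Longrightarrow> L \<sigma> \<in> borel_prob_measures X"
      "\<And>\<sigma>. \<sigma> \<in> code_trees M N \<Longrightarrow> L \<sigma> = mix (\<sigma> []) (\<lambda>m. L (subtree M \<sigma> m))"
    using self_similar_measures_exist by metis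
  have eq: "tree_measure X M f p \<sigma> = L \<sigma>" if "\<sigma> \<in> code_trees M N" for \<sigma>
    by (rule tree_measure_eqI[OF L that])
  assume \<sigma>: "\<sigma> \<in> code_trees M N"
  show "tree_measure X M f p \<sigma> \<in> borel_prob_measures X" by (simp only: eq[OF \<sigma>] L(1)[OF \<sigma>])
  have "mix (\<sigma> []) (\<lambda>m. tree_measure X M f p (subtree M \<sigma> m)) = mix (\<sigma> []) (\<lambda>m. L (subtree M \<sigma> m))"
    by (rule mix_cong) (rule eq[OF subtree_in_code_trees[OF \<sigma>]])
  then show "tree_measure X M f p \<sigma> = mix (\<sigma> []) (\<lambda>m. tree_measure X M f p (subtree M \<sigma> m))"
    by (simp only: eq[OF \<sigma>] L(2)[OF \<sigma>, symmetric])
qed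

lemma tree_measure_tree_join:
  assumes n: "n \<in> {1..N}" and \<omega>: "\<And>m. m \<in> {1..M} \<Longrightarrow> \<omega> m \<in> code_trees M N"
  shows "tree_measure X M f p (tree_join M n \<omega>) = mix n (\<lambda>m. tree_measure X M f p (\<omega> m))"
proof -
  have "tree_join M n \<omega> [] = n" by (simp add: tree_join_def)
  then show ?thesis
    using tree_measure_unfold[OF tree_join_in_code_trees[OF n \<omega>]]
      mix_cong[of "\<lambda>m. tree_measure X M f p (subtree M (tree_join M n \<omega>) m)" "\<lambda>m. tree_measure X M f p (\<omega> m)" n]
      subtree_tree_join[OF _ \<omega>] by simp
qed

section \<open>Continuity of the tree measure in the code tree\<close>

lemma MK_dist_tree_measure:
  assumes "\<sigma> \<in> code_trees M N" "\<kappa> \<in> code_trees M N"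
    and "\<And>i. i \<in> lists {1..M} \<Longrightarrow> length i < k \<Longrightarrow> \<sigma> i = \<kappa> i"
  shows "MK_dist X (tree_measure X M f p \<sigma>) (tree_measure X M f p \<kappa>) \<le> l ^ k * (2 * D)"
  using assms
proof (induction k arbitrary: \<sigma> \<kappa>)
  case 0
  then show ?case using MK_dist_le_diam[OF diam] tree_measure_in_borel_prob_measures by simp
next
  case (Suc k)
  note s = subtree_in_code_trees[OF Suc.prems(1)] subtree_in_code_trees[OF Suc.prems(2)]
  \<comment> \<open>Equal roots exhibit both measures as values of the same \<open>mix\<close>, to
    which its contraction estimate applies.\<close>
  have root: "\<kappa> [] = \<sigma> []" using Suc.prems(3)[of "[]"] by simp
  have "MK_dist X (tree_measure X M f p (subtree M \<sigma> m)) (tree_measure X M f p (subtree M \<kappa> m)) \<le> l ^ k * (2 * D)"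
    if m: "m \<in> {1..M}" for m
  proof (rule Suc.IH[OF s(1)[OF m] s(2)[OF m]])
    fix i assume "i \<in> lists {1..M}" "length i < k"
    then show "subtree M \<sigma> m i = subtree M \<kappa> m i"
      using Suc.prems(3)[of "m # i"] m by (simp add: subtree_def)
  qed
  then have "MK_dist X (mix (\<sigma> []) (\<lambda>m. tree_measure X M f p (subtree M \<sigma> m)))
      (mix (\<sigma> []) (\<lambda>m. tree_measure X M f p (subtree M \<kappa> m))) \<le> l * (l ^ k * (2 * D))"
    by (intro MK_dist_mix root_in_labels[OF Suc.prems(1)] tree_measure_in_borel_prob_measures s)
  then show ?case
    by (simp only: tree_measure_unfold[OF Suc.prems(1), symmetric]
        tree_measure_unfold[OF Suc.prems(2), unfolded root, symmetric] power_Suc mult.assoc)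
qed

lemma continuous_map_tree_measure:
  "continuous_map (mtopology_of (code_tree_metric M N)) (mtopology_of (MK_metric X)) (tree_measure X M f p)"
proof (rule continuous_map_mtopology_of)
  show "tree_measure X M f p \<in> mspace (code_tree_metric M N) \<rightarrow> mspace (MK_metric X)"
    using tree_measure_in_borel_prob_measures M
    by (simp add: code_tree_metric_simps(1) MK_metric_simps(1)[OF X(2)])
  fix \<sigma> and r :: real assume \<sigma>: "\<sigma> \<in> mspace (code_tree_metric M N)" and r: "r > 0"
  obtain k where k: "\<And>j. k \<le> j \<Longrightarrow> l ^ j * (2 * D) < r" using power_l_small[OF r] by blast
  show "\<exists>d>0. \<forall>\<kappa>\<in>mspace (code_tree_metric M N). mdist (code_tree_metric M N) \<sigma> \<kappa> < d \<longrightarrow>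
      mdist (MK_metric X) (tree_measure X M f p \<sigma>) (tree_measure X M f p \<kappa>) < r"
  \<comment> \<open>A disagreement at a word shorter than \<open>k\<close> would put the trees at
    distance at least \<open>1 / real M ^ k\<close>.\<close>
  proof (intro exI[of _ "1 / real M ^ k"] conjI ballI impI)
    show "0 < 1 / real M ^ k" using M by simp
    fix \<kappa> assume \<kappa>: "\<kappa> \<in> mspace (code_tree_metric M N)" and d: "mdist (code_tree_metric M N) \<sigma> \<kappa> < 1 / real M ^ k"
    have "\<sigma> i = \<kappa> i" if i: "i \<in> lists {1..M}" "length i < k" for i
    proof (rule ccontr)
      assume "\<sigma> i \<noteq> \<kappa> i"
      then have "1 / real M ^ length i \<le> code_tree_dist M \<sigma> \<kappa>" by (rule code_tree_dist_ge[of M i \<sigma> \<kappa>, OF M i(1)])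
      moreover have "1 / real M ^ k \<le> 1 / real M ^ length i"
        using M i(2) by (intro divide_left_mono power_increasing) simp_all
      ultimately show False using d M by (simp add: code_tree_metric_simps(2))
    qed
    then have "MK_dist X (tree_measure X M f p \<sigma>) (tree_measure X M f p \<kappa>) \<le> l ^ k * (2 * D)"
      using \<sigma> \<kappa> M by (intro MK_dist_tree_measure) (simp_all add: code_tree_metric_simps(1))
    then show "mdist (MK_metric X) (tree_measure X M f p \<sigma>) (tree_measure X M f p \<kappa>) < r"
      using k[of k] by (simp add: MK_metric_simps(2)[OF X(2)])
  qed
qed

section \<open>The IFS on tuples of measures\<close>

lemma diam_le_MK_metric: "diam_le (MK_metric X) (2 * D)"
  unfolding diam_le_def MK_metric_simps[OF X(2)] using MK_dist_le_diam[OF diam] by blast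

lemma f_map_eq_mix:
  "f_map X V M f p a \<mu> = (\<lambda>v\<in>{1..V}. mix (fst (a v)) (\<lambda>m. \<mu> (snd (a v) m)))"
  by (simp add: f_map_def mix_def)

lemma f_map_into:
  assumes V: "V \<ge> 1" and a: "a \<in> ifs_indices N V M"
  shows "f_map X V M f p a \<in> mspace (power_metric V (MK_metric X)) \<rightarrow> mspace (power_metric V (MK_metric X))"
proof
  fix \<mu> assume \<mu>: "\<mu> \<in> mspace (power_metric V (MK_metric X))"
  have "mix (fst (a v)) (\<lambda>m. \<mu> (snd (a v) m)) \<in> borel_prob_measures X" if v: "v \<in> {1..V}" for v
  proof (rule mix_in_borel_prob_measures[OF ifs_indicesD(1)[OF a v]])
    fix m assume "m \<in> {1..M}"
    then show "\<mu> (snd (a v) m) \<in> borel_prob_measures X"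
      using power_metric_component[OF \<mu> ifs_indicesD(3)[OF a v]] by (simp add: MK_metric_simps(1)[OF X(2)])
  qed
  then show "f_map X V M f p a \<mu> \<in> mspace (power_metric V (MK_metric X))"
    unfolding f_map_eq_mix power_metric_simps(1)[OF V] MK_metric_simps(1)[OF X(2)]
    by (intro restrict_PiE_iff[THEN iffD2] ballI)
qed

lemma f_map_contraction:
  assumes V: "V \<ge> 1" and a: "a \<in> ifs_indices N V M"
    and \<mu>: "\<mu> \<in> mspace (power_metric V (MK_metric X))" and \<nu>: "\<nu> \<in> mspace (power_metric V (MK_metric X))"
  shows "mdist (power_metric V (MK_metric X)) (f_map X V M f p a \<mu>) (f_map X V M f p a \<nu>)
          \<le> l * mdist (power_metric V (MK_metric X)) \<mu> \<nu>"
proof (rule mdist_power_leI[OF V])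
  fix v assume v: "v \<in> {1..V}"
  note s = ifs_indicesD(3)[OF a v]
  have "MK_dist X (mix (fst (a v)) (\<lambda>m. \<mu> (snd (a v) m))) (mix (fst (a v)) (\<lambda>m. \<nu> (snd (a v) m)))
      \<le> l * mdist (power_metric V (MK_metric X)) \<mu> \<nu>"
  proof (rule MK_dist_mix[OF ifs_indicesD(1)[OF a v]])
    fix m assume m: "m \<in> {1..M}"
    show "\<mu> (snd (a v) m) \<in> borel_prob_measures X" "\<nu> (snd (a v) m) \<in> borel_prob_measures X"
      using power_metric_component[OF \<mu> s[OF m]] power_metric_component[OF \<nu> s[OF m]]
      by (simp_all add: MK_metric_simps(1)[OF X(2)])
    show "MK_dist X (\<mu> (snd (a v) m)) (\<nu> (snd (a v) m)) \<le> mdist (power_metric V (MK_metric X)) \<mu> \<nu>"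
      using mdist_power_ge[OF s[OF m], of "MK_metric X" \<mu> \<nu>] by (simp add: MK_metric_simps(2)[OF X(2)])
  qed
  then show "mdist (MK_metric X) (f_map X V M f p a \<mu> v) (f_map X V M f p a \<nu> v)
      \<le> l * mdist (power_metric V (MK_metric X)) \<mu> \<nu>"
    using v by (simp add: f_map_eq_mix MK_metric_simps(2)[OF X(2)])
qed

text \<open>Each component of \<open>eta_map\<close> is a joined tree, whose measure is the
  \<open>mix\<close> of the measures of the trees selected by \<open>a\<close>; this is a component
  of \<open>f_map\<close>.\<close>

lemma tree_measures_eta_map:
  assumes V: "V \<ge> 1" and a: "a \<in> ifs_indices N V M"
    and \<omega>: "\<omega> \<in> {1..V} \<rightarrow>\<^sub>E code_trees M N"
  shows "tree_measures X V M f p (eta_map V M a \<omega>) = f_map X V M f p a (tree_measures X V M f p \<omega>)"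
  unfolding f_map_eq_mix tree_measures_def
proof (rule restrict_ext)
  fix v assume v: "v \<in> {1..V}"
  note s = ifs_indicesD(3)[OF a v]
  have "tree_measure X M f p (eta_map V M a \<omega> v)
      = mix (fst (a v)) (\<lambda>m. tree_measure X M f p ((\<lambda>m\<in>{1..M}. \<omega> (snd (a v) m)) m))"
  proof -
    have "eta_map V M a \<omega> v = tree_join M (fst (a v)) (\<lambda>m\<in>{1..M}. \<omega> (snd (a v) m))"
      using v by (simp add: eta_map_def)
    moreover have "(\<lambda>m\<in>{1..M}. \<omega> (snd (a v) m)) m \<in> code_trees M N" if "m \<in> {1..M}" for m
      using PiE_mem[OF \<omega> s[OF that]] that by simp
    ultimately show ?thesis by (simp only: tree_measure_tree_join[OF ifs_indicesD(1)[OF a v]])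
  qed
  also have "\<dots> = mix (fst (a v)) (\<lambda>m. (\<lambda>v\<in>{1..V}. tree_measure X M f p (\<omega> v)) (snd (a v) m))"
    by (rule mix_cong) (use s in simp)
  finally show "tree_measure X M f p (eta_map V M a \<omega> v)
      = mix (fst (a v)) (\<lambda>m. (\<lambda>v\<in>{1..V}. tree_measure X M f p (\<omega> v)) (snd (a v) m))" .
qed

lemma continuous_map_tree_measures:
  assumes "V \<ge> 1"
  shows "continuous_map (mtopology_of (power_metric V (code_tree_metric M N)))
           (mtopology_of (power_metric V (MK_metric X))) (tree_measures X V M f p)"
  using continuous_map_power_metric[OF assms continuous_map_tree_measure]
  by (simp add: tree_measures_def[abs_def])

end

section \<open>Transport of invariant measures\<close>

lemma push_forward_weighted_sum:
  assumes I: "finite I" and \<mu>: "\<And>i. i \<in> I \<Longrightarrow> sets (\<mu> i) = sets (borel_of_metric m)"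
    and h: "h \<in> measurable (borel_of_metric m) (borel_of_metric m')"
  shows "push_forward m' h (weighted_sum m I w \<mu>) = weighted_sum m' I w (\<lambda>i. push_forward m' h (\<mu> i))"
proof (rule weighted_sum_eqI[OF I])
  fix B assume B: "B \<in> sets (borel_of_metric m')"
  have h': "h \<in> measurable \<nu> (borel_of_metric m')" if "sets \<nu> = sets (borel_of_metric m)" for \<nu>
    using h by (simp add: measurable_cong_sets[OF that refl])
  have sp: "space (\<mu> i) = mspace m" if "i \<in> I" for i
    using sets_eq_imp_space_eq[OF \<mu>[OF that]] by simp
  have hB: "h -` B \<inter> mspace m \<in> sets (borel_of_metric m)" using measurable_sets[OF h B] by simp
  have "emeasure (push_forward m' h (weighted_sum m I w \<mu>)) B = emeasure (weighted_sum m I w \<mu>) (h -` B \<inter> mspace m)"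
    by (subst emeasure_distr[OF h'[OF sets_weighted_sum] B]) simp
  also have "\<dots> = (\<Sum>i\<in>I. ennreal (w i) * emeasure (\<mu> i) (h -` B \<inter> mspace m))"
    by (rule emeasure_weighted_sum[OF I \<mu> hB])
  also have "\<dots> = (\<Sum>i\<in>I. ennreal (w i) * emeasure (push_forward m' h (\<mu> i)) B)"
    using B h'[OF \<mu>] sp by (intro sum.cong refl) (simp add: emeasure_distr)
  finally show "emeasure (push_forward m' h (weighted_sum m I w \<mu>)) B
      = (\<Sum>i\<in>I. ennreal (w i) * emeasure (push_forward m' h (\<mu> i)) B)" .
qed simp_all

text \<open>The semi-conjugacy carries \<open>h\<close> through each term of the weighted sum. It is
  required on the carrier, which is the space of \<open>\<mu>\<close>, so both composites have the
  same push-forward.\<close>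

lemma push_forward_invariant_measure:
  assumes I: "finite I" and h: "h \<in> measurable (borel_of_metric m) (borel_of_metric m')"
    and g: "\<And>i. i \<in> I \<Longrightarrow> g i \<in> measurable (borel_of_metric m) (borel_of_metric m)"
    and g': "\<And>i. i \<in> I \<Longrightarrow> g' i \<in> measurable (borel_of_metric m') (borel_of_metric m')"
    and conj: "\<And>i x. i \<in> I \<Longrightarrow> x \<in> mspace m \<Longrightarrow> h (g i x) = g' i (h x)"
    and \<mu>: "\<mu> \<in> borel_prob_measures m" "\<mu> = weighted_sum m I w (\<lambda>i. push_forward m (g i) \<mu>)"
  shows "push_forward m' h \<mu> = weighted_sum m' I w (\<lambda>i. push_forward m' (g' i) (push_forward m' h \<mu>))"
proof -
  have meas: "k \<in> measurable \<mu> (borel_of_metric m'')"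
    if "k \<in> measurable (borel_of_metric m) (borel_of_metric m'')" for k and m'' :: "'d metric"
    using that by (simp add: measurable_cong_sets[OF borel_prob_measuresD(2)[OF \<mu>(1)] refl])
  have "push_forward m' h \<mu> = push_forward m' h (weighted_sum m I w (\<lambda>i. push_forward m (g i) \<mu>))"
    by (rule arg_cong[OF \<mu>(2)])
  also have "\<dots> = weighted_sum m' I w (\<lambda>i. push_forward m' h (push_forward m (g i) \<mu>))"
    by (rule push_forward_weighted_sum[OF I _ h]) simp
  also have "\<dots> = weighted_sum m' I w (\<lambda>i. push_forward m' (g' i) (push_forward m' h \<mu>))"
  proof (rule weighted_sum_cong[OF I])
    fix i assume i: "i \<in> I"
    have "push_forward m' h (push_forward m (g i) \<mu>) = push_forward m' (h \<circ> g i) \<mu>"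
      by (rule distr_distr[OF h meas[OF g[OF i]]])
    also have "\<dots> = push_forward m' (g' i \<circ> h) \<mu>"
      using conj[OF i] borel_prob_measuresD(3)[OF \<mu>(1)] by (intro distr_cong) simp_all
    also have "\<dots> = push_forward m' (g' i) (push_forward m' h \<mu>)"
      by (rule distr_distr[symmetric, OF g'[OF i] meas[OF h]])
    finally show "push_forward m' h (push_forward m (g i) \<mu>) = push_forward m' (g' i) (push_forward m' h \<mu>)" .
  qed simp_all
  finally show ?thesis .
qed

lemma compact_diam_le:
  assumes "compact_space (mtopology_of m)"
  obtains D where "diam_le m D"
proof -
  interpret Metric_space "mspace m" "mdist m" by simp
  have "mbounded (mspace m)"
    using assms compactin_imp_mbounded by (simp add: compact_space_def mtopology_of_def)
  then show ?thesis using that unfolding mbounded_alt diam_le_def by blast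
qed

theorem theorem22:
  fixes X :: "'a metric" and M N V :: nat and l :: real
    and f :: "nat \<Rightarrow> nat \<Rightarrow> 'a \<Rightarrow> 'a" and p :: "nat \<Rightarrow> nat \<Rightarrow> real"
    and P :: "nat \<Rightarrow> real" and prob :: "ifs_index \<Rightarrow> real"
  assumes X: "mspace X \<noteq> {}" "compact_space (mtopology_of X)"
    and params: "M \<ge> 2" "N \<ge> 1" "V \<ge> 1" "0 \<le> l" "l < 1"
    and f_into: "\<And>n m. n \<in> {1..N} \<Longrightarrow> m \<in> {1..M} \<Longrightarrow> f n m \<in> mspace X \<rightarrow> mspace X"
    and f_lipschitz: "\<And>n m x y. n \<in> {1..N} \<Longrightarrow> m \<in> {1..M} \<Longrightarrow> x \<in> mspace X \<Longrightarrow> y \<in> mspace X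
          \<Longrightarrow> mdist X (f n m x) (f n m y) \<le> l * mdist X x y"
    and p_nonneg: "\<And>n m. n \<in> {1..N} \<Longrightarrow> m \<in> {1..M} \<Longrightarrow> p n m \<ge> 0"
    and p_sum: "\<And>n. n \<in> {1..N} \<Longrightarrow> (\<Sum>m=1..M. p n m) = 1"
    and P_pos: "\<And>n. n \<in> {1..N} \<Longrightarrow> P n > 0"
    and P_sum: "(\<Sum>n=1..N. P n) = 1"
    and prob_nonneg: "\<And>a. a \<in> ifs_indices N V M \<Longrightarrow> prob a \<ge> 0"
    and prob_sum: "(\<Sum>a\<in>ifs_indices N V M. prob a) = 1"
  defines "\<A> \<equiv> ifs_indices N V M"
    and "\<Omega> \<equiv> code_tree_metric M N"
    and "\<eta> \<equiv> eta_map V M"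
    and "fa \<equiv> f_map X V M f p"
    and "F \<equiv> tree_measure X M f p"
    and "F\<^sub>V \<equiv> tree_measures X V M f p"
  defines "\<Omega>V \<equiv> power_metric V \<Omega>"
    and "PV \<equiv> power_metric V (MK_metric X)"
  defines "\<Omega>_set \<equiv> set_attractor \<Omega>V \<A> \<eta>"
    and "H_set \<equiv> set_attractor PV \<A> fa"
    and "\<Omega>_meas \<equiv> measure_attractor \<Omega>V \<A> \<eta> prob"
    and "H_meas \<equiv> measure_attractor PV \<A> fa prob"
  shows "(\<forall>a\<in>\<A>. \<forall>\<omega> \<in> {1..V} \<rightarrow>\<^sub>E code_trees M N. F\<^sub>V (\<eta> a \<omega>) = fa a (F\<^sub>V \<omega>))
       \<and> F\<^sub>V ` \<Omega>_set = H_set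
       \<and> F ` ((\<lambda>\<omega>. \<omega> 1) ` \<Omega>_set) = (\<lambda>\<mu>. \<mu> 1) ` H_set
       \<and> ((\<forall>a\<in>\<A>. prob a = (\<Prod>v=1..V. P (fst (a v))) / real (V ^ (M * V))) \<longrightarrow>
            push_forward PV F\<^sub>V \<Omega>_meas = H_meas
          \<and> push_forward (MK_metric X) F (push_forward \<Omega> (\<lambda>\<omega>. \<omega> 1) \<Omega>_meas)
              = push_forward (MK_metric X) (\<lambda>\<mu>. \<mu> 1) H_meas)"
proof -
  have M1: "M \<ge> 1" and V: "V \<ge> 1" using params by simp_all
  obtain D where D: "diam_le X D" using compact_diam_le[OF X(2)] .
  \<comment> \<open>The constant must lie strictly between 0 and 1, and \<open>l\<close> may be 0;
    the value 1/2 is an arbitrary choice in that interval.\<close>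
  define c where "c = max l (1 / 2)"
  have c: "0 < c" "c < 1" "l \<le> c" using params(5) by (simp_all add: c_def)
  interpret superifs X M N c D f p
  proof
    fix n m x y assume nm: "n \<in> {1..N}" "m \<in> {1..M}" "x \<in> mspace X" "y \<in> mspace X"
    have "mdist X (f n m x) (f n m y) \<le> l * mdist X x y" by (rule f_lipschitz[OF nm])
    also have "\<dots> \<le> c * mdist X x y" using c(3) by (intro mult_right_mono) simp_all
    finally show "mdist X (f n m x) (f n m y) \<le> c * mdist X x y" .
  qed (fact X D M1 c f_into p_nonneg p_sum)+
  note defs = \<A>_def \<Omega>_def \<eta>_def fa_def F_def F\<^sub>V_def \<Omega>V_def PV_def
  have m\<Omega>V: "mspace \<Omega>V = {1..V} \<rightarrow>\<^sub>E code_trees M N"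
    by (simp only: defs power_metric_simps(1)[OF V] code_tree_metric_simps(1)[OF M1])
  have conj: "F\<^sub>V (\<eta> a \<omega>) = fa a (F\<^sub>V \<omega>)" if "a \<in> \<A>" "\<omega> \<in> mspace \<Omega>V" for a \<omega>
    using tree_measures_eta_map[OF V that(1)[unfolded \<A>_def] that(2)[unfolded m\<Omega>V]]
    by (simp only: defs)
  have A: "finite \<A>" "\<A> \<noteq> {}"
    using finite_ifs_indices ifs_indices_nonempty[OF params(2,3)] by (simp_all only: defs not_False_eq_True)
  have addr: "address_map \<Omega>V 1 (1 / real M) {()} \<A> (\<lambda>_ _. ()) (\<lambda>_. \<eta>) (\<lambda>_. address_trees V M)"
    unfolding defs by (rule address_map_code_trees[OF V params(1)])
  have dO: "diam_le \<Omega>V 1"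
    unfolding defs by (rule diam_le_power_metric[OF V diam_le_code_tree_metric[OF M1]])
  have cM: "0 < 1 / real M" "1 / real M < 1" using params(1) by simp_all
  have e_into: "\<eta> a \<in> mspace \<Omega>V \<rightarrow> mspace \<Omega>V" if "a \<in> \<A>" for a
    using that unfolding defs by (rule eta_map_into[OF V M1])
  have e_contr: "mdist \<Omega>V (\<eta> a x) (\<eta> a y) \<le> 1 / real M * mdist \<Omega>V x y"
    if "a \<in> \<A>" "x \<in> mspace \<Omega>V" "y \<in> mspace \<Omega>V" for a x y
    using that unfolding defs by (rule eta_map_contraction[OF V M1])
  have dP: "diam_le PV (2 * D)"
    unfolding defs by (rule diam_le_power_metric[OF V diam_le_MK_metric])
  have f_into: "fa a \<in> mspace PV \<rightarrow> mspace PV" if "a \<in> \<A>" for a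
    using that unfolding defs by (rule f_map_into[OF V])
  have f_contr: "mdist PV (fa a x) (fa a y) \<le> c * mdist PV x y"
    if "a \<in> \<A>" "x \<in> mspace PV" "y \<in> mspace PV" for a x y
    using that unfolding defs by (rule f_map_contraction[OF V])
  have Fc: "continuous_map (mtopology_of \<Omega>V) (mtopology_of PV) F\<^sub>V"
    unfolding defs by (rule continuous_map_tree_measures[OF V])

  \<comment> \<open>Set attractors\<close>
  obtain S where S: "S \<noteq> {}" "compactin (mtopology_of \<Omega>V) S" "S = (\<Union>a\<in>\<A>. \<eta> a ` S)"
    using invariant_set_exists[OF addr A] by (elim exE conjE)
  have \<Omega>S: "\<Omega>_set = S"
    unfolding \<Omega>_set_def by (rule set_attractor_eqI[OF dO less_imp_le[OF cM(1)] cM(2) e_contr S])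
  have Ssub: "S \<subseteq> mspace \<Omega>V" using compactin_subset_topspace[OF S(2)] by simp
  have "F\<^sub>V ` S = (\<Union>a\<in>\<A>. F\<^sub>V ` \<eta> a ` S)"
    using arg_cong[OF S(3), of "image F\<^sub>V"] by (simp only: image_UN)
  also have "\<dots> = (\<Union>a\<in>\<A>. fa a ` F\<^sub>V ` S)"
    unfolding image_image
    by (intro SUP_cong refl image_cong conj) (use Ssub in blast)+
  finally have Finv: "F\<^sub>V ` S = (\<Union>a\<in>\<A>. fa a ` F\<^sub>V ` S)" .
  have FS: "F\<^sub>V ` S \<noteq> {}" using S(1) by (simp only: image_is_empty not_False_eq_True)
  have HS: "H_set = F\<^sub>V ` S"
    unfolding H_set_def
    by (rule set_attractor_eqI[OF dP less_imp_le[OF c(1)] c(2) f_contr FS image_compactin[OF S(2) Fc] Finv])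
  \<comment> \<open>This identity yields both claims on first components, the one on sets and the
    one on marginals.\<close>
  have F1: "F (\<omega> 1) = F\<^sub>V \<omega> 1" for \<omega>
    using V by (simp add: defs tree_measures_def)
  have sets: "F\<^sub>V ` \<Omega>_set = H_set" "F ` ((\<lambda>\<omega>. \<omega> 1) ` \<Omega>_set) = (\<lambda>\<mu>. \<mu> 1) ` H_set"
    by (simp_all only: \<Omega>S HS image_image F1)

  \<comment> \<open>Measure attractors and their marginals\<close>
  have w: "\<And>a. a \<in> \<A> \<Longrightarrow> 0 \<le> prob a" "sum prob \<A> = 1"
    using prob_nonneg prob_sum unfolding defs by blast+
  have "\<exists>\<mu>\<in>borel_prob_measures \<Omega>V. \<mu> = weighted_sum \<Omega>V \<A> prob (\<lambda>a. push_forward \<Omega>V (\<eta> a) \<mu>)"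
    by (rule invariant_measure_exists[OF addr A(1) w])
  then obtain \<mu> where \<mu>: "\<mu> \<in> borel_prob_measures \<Omega>V" "\<mu> = weighted_sum \<Omega>V \<A> prob (\<lambda>a. push_forward \<Omega>V (\<eta> a) \<mu>)"
    by (elim bexE)
  have \<Omega>M: "\<Omega>_meas = \<mu>"
    unfolding \<Omega>_meas_def by (rule measure_attractor_eqI[OF dO A(1) cM w e_into e_contr \<mu>])
  have Fm: "F\<^sub>V \<in> measurable (borel_of_metric \<Omega>V) (borel_of_metric PV)"
    by (rule continuous_map_borel_measurable[OF Fc])
  have inv: "push_forward PV F\<^sub>V \<mu> = weighted_sum PV \<A> prob (\<lambda>a. push_forward PV (fa a) (push_forward PV F\<^sub>V \<mu>))"
    by (rule push_forward_invariant_measure[OF A(1) Fm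
          continuous_map_borel_measurable[OF lipschitz_continuous_map[OF e_into e_contr]]
          continuous_map_borel_measurable[OF lipschitz_continuous_map[OF f_into f_contr]] conj \<mu>])
  have HM: "H_meas = push_forward PV F\<^sub>V \<mu>"
    unfolding H_meas_def
    by (rule measure_attractor_eqI[OF dP A(1) c(1,2) w f_into f_contr
          push_forward_in_borel_prob_measures[OF \<mu>(1) Fm] inv])
  have one: "1 \<in> {1..V}" using V by simp
  have m\<mu>: "k \<in> measurable \<mu> K" if "k \<in> measurable (borel_of_metric \<Omega>V) K"
    for k :: "(nat \<Rightarrow> code_tree) \<Rightarrow> 'z" and K
    using that by (simp add: measurable_cong_sets[OF borel_prob_measuresD(2)[OF \<mu>(1)] refl])
  have c1: "(\<lambda>\<omega>. \<omega> 1) \<in> measurable (borel_of_metric \<Omega>V) (borel_of_metric \<Omega>)"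
    unfolding defs by (intro continuous_map_borel_measurable continuous_map_power_component one)
  have c2: "F \<in> measurable (borel_of_metric \<Omega>) (borel_of_metric (MK_metric X))"
    unfolding defs by (intro continuous_map_borel_measurable continuous_map_tree_measure)
  have c3: "(\<lambda>\<mu>. \<mu> 1) \<in> measurable (borel_of_metric PV) (borel_of_metric (MK_metric X))"
    unfolding defs by (intro continuous_map_borel_measurable continuous_map_power_component one)
  \<comment> \<open>Both sides are push-forwards of \<open>\<mu>\<close> along one map, taking the
    first tree and then its measure, or the other way round.\<close>
  have "push_forward (MK_metric X) F (push_forward \<Omega> (\<lambda>\<omega>. \<omega> 1) \<mu>)
      = push_forward (MK_metric X) (F \<circ> (\<lambda>\<omega>. \<omega> 1)) \<mu>"
    by (rule distr_distr[OF c2 m\<mu>[OF c1]])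
  also have "F \<circ> (\<lambda>\<omega>. \<omega> 1) = (\<lambda>\<mu>. \<mu> 1) \<circ> F\<^sub>V"
    by (simp only: comp_def F1)
  also have "push_forward (MK_metric X) ((\<lambda>\<mu>. \<mu> 1) \<circ> F\<^sub>V) \<mu>
      = push_forward (MK_metric X) (\<lambda>\<mu>. \<mu> 1) (push_forward PV F\<^sub>V \<mu>)"
    by (rule distr_distr[symmetric, OF c3 m\<mu>[OF Fm]])
  finally have "push_forward (MK_metric X) F (push_forward \<Omega> (\<lambda>\<omega>. \<omega> 1) \<mu>)
      = push_forward (MK_metric X) (\<lambda>\<mu>. \<mu> 1) (push_forward PV F\<^sub>V \<mu>)" .
  then show ?thesis
    using conj sets unfolding m\<Omega>V \<Omega>M HM by (intro conjI ballI impI refl)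
qed

end
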